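(* Let $u(x)=(1-x)^\gamma(1+x)^\delta$, $x\in[-1,1]$, be a given Jacobi weight with $\gamma,\delta\ge 0$, and let $w\in\{w_1,w_2,w_3,w_4\}$ be any of the four Chebyshev weights, with respect to which the de la Vallée Poussin interpolation operators $V_n^m$ are defined. Let $C>1$ be a fixed constant, and let $n\sim m$ mean that $n,m$ range over the positive integers with $m<n\le C m$. Then $$\sup_{n\sim m}\|V_n^m\|_u<\infty$$ if and only if the exponents $\gamma$ and $\delta$ satisfy the following bounds: - in the case $w=w_1$: $0\le\gamma\le 1$ and $0\le\delta\le 1$; - in the case $w=w_2$: $0<\gamma\le 3/2$ and $0<\delta\le 3/2$ and $-1\le\gamma-\delta\le 1$; - in the case $w=w_3$: $0\le\gamma\le 1$ and $0<\delta\le 3/2$ and $\gamma-\delta\le 1/2$; - in the case $w=w_4$: $0<\gamma\le 3/2$ and $0\le\delta\le 1$ and $\gamma-\delta\ge -1/2$.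
   Context: Chebyshev weights on $(-1,1)$: $w_1(x)=\frac{1}{\sqrt{1-x^2}}$, $w_2(x)=\sqrt{1-x^2}$, $w_3(x)=\sqrt{\frac{1+x}{1-x}}$, $w_4(x)=\sqrt{\frac{1-x}{1+x}}$. For $w$ one of these, $\{p_n(w,x)\}_{n\ge 0}$ is the system of orthonormal polynomials with respect to $w$ on $[-1,1]$ with positive leading coefficients ($\deg p_n=n$). The zeros of $p_n(w,\cdot)$ are $x_k=\cos t_k$, $k=1,\dots,n$, with $t_k=\frac{(2k-1)\pi}{2n}$ if $w=w_1$; $t_k=\frac{k\pi}{n+1}$ if $w=w_2$; $t_k=\frac{(2k-1)\pi}{2n+1}$ if $w=w_3$; $t_k=\frac{2k\pi}{2n+1}$ if $w=w_4$. The Christoffel numbers are $\lambda_{n,k}=\Big(\sum_{j=0}^{n}p_j(w,x_k)^2\Big)^{-1}$, $k=1,\dots,n$; that is, $\lambda_{n,k}=\frac{\pi}{n}$ if $w=w_1$; $\frac{\pi}{n+1}\sin^2 t_k$ if $w=w_2$; $\frac{4\pi}{2n+1}\cos^2\frac{t_k}{2}$ if $w=w_3$; $\frac{4\pi}{2n+1}\sin^2\frac{t_k}{2}$ if $w=w_4$. For positive integers $m<n$, the fundamental de la Vallée Poussin (VP) polynomials are $$\Phi_{n,k}^m(x)=\lambda_{n,k}\sum_{j=0}^{n+m-1}\mu_{n,j}^m\,p_j(w,x)\,p_j(w,x_k),\qquad k=1,\dots,n,$$ where $\mu_{n,j}^m=1$ if $0\le j\le n-m$ and $\mu_{n,j}^m=\frac{n+m-j}{2m}$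 if $n-m<j<n+m$. The VP polynomial of a function $f$ is $$V_n^mf(x)=\sum_{k=1}^n f(x_k)\,\Phi_{n,k}^m(x),\qquad |x|\le 1 .$$ Write $\|g\|=\sup_{|x|\le 1}|g(x)|$. The functions $f$ considered are real functions defined everywhere on $(-1,1)$, possibly unbounded at the endpoints, such that $\lim_{x\to 1}f(x)u(x)=0$ if $u(1)=0$ and $\lim_{x\to -1}f(x)u(x)=0$ if $u(-1)=0$. At an endpoint where $u$ vanishes the product $fu$ is taken to be $0$; where $u(\pm1)\neq 0$, $f$ is taken to be defined at that endpoint too. The Lebesgue constant is $$\|V_n^m\|_u=\sup_{f\ne 0}\frac{\|(V_n^mf)u\|}{\|fu\|},$$ the supremum being over such $f$ with $0<\|fu\|<\infty$. Equivalently, $$\|V_n^m\|_u=\sup_{|x|\le 1}u(x)\sum_{k=1}^n\frac{|\Phi_{n,k}^m(x)|}{u(x_k)}.$$ *)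

theory Defs
  imports "HOL-Analysis.Analysis" "HOL-Computational_Algebra.Polynomial"
begin

datatype chebyshev = W1 | W2 | W3 | W4

fun cheb_weight :: "chebyshev \<Rightarrow> real \<Rightarrow> real" where
  "cheb_weight W1 x = 1 / sqrt (1 - x\<^sup>2)"
| "cheb_weight W2 x = sqrt (1 - x\<^sup>2)"
| "cheb_weight W3 x = sqrt ((1 + x) / (1 - x))"
| "cheb_weight W4 x = sqrt ((1 - x) / (1 + x))"

definition orthonormal_system :: "(real \<Rightarrow> real) \<Rightarrow> (nat \<Rightarrow> real poly) \<Rightarrow> bool" where
  "orthonormal_system w p \<longleftrightarrow>
     (\<forall>n. degree (p n) = n \<and> lead_coeff (p n) > 0) \<and>
     (\<forall>i j. (LBINT x:{-1<..<1}. poly (p i) x * poly (p j) x * w x) = (if i = j then 1 else 0))"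

definition orthonormal_poly :: "(real \<Rightarrow> real) \<Rightarrow> nat \<Rightarrow> real poly" where
  "orthonormal_poly w = (THE p. orthonormal_system w p)"

abbreviation cheb_poly :: "chebyshev \<Rightarrow> nat \<Rightarrow> real \<Rightarrow> real" where
  "cheb_poly w n x \<equiv> poly (orthonormal_poly (cheb_weight w) n) x"

fun cheb_angle :: "chebyshev \<Rightarrow> nat \<Rightarrow> nat \<Rightarrow> real" where
  "cheb_angle W1 n k = (2 * real k - 1) * pi / (2 * real n)"
| "cheb_angle W2 n k = real k * pi / (real n + 1)"
| "cheb_angle W3 n k = (2 * real k - 1) * pi / (2 * real n + 1)"
| "cheb_angle W4 n k = 2 * real k * pi / (2 * real n + 1)"

text \<open>The zeros of the orthonormal polynomial of degree \<open>n\<close>, in decreasing order for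
  \<open>k = 1, \<dots>, n\<close>.\<close>

definition cheb_zero :: "chebyshev \<Rightarrow> nat \<Rightarrow> nat \<Rightarrow> real" where
  "cheb_zero w n k = cos (cheb_angle w n k)"

definition christoffel :: "chebyshev \<Rightarrow> nat \<Rightarrow> nat \<Rightarrow> real" where
  "christoffel w n k = inverse (\<Sum>j=0..n. (cheb_poly w j (cheb_zero w n k))\<^sup>2)"

text \<open>From here on \<open>n\<close> and \<open>m\<close> are meant to satisfy \<open>0 < m < n\<close>.\<close>

definition vp_coeff :: "nat \<Rightarrow> nat \<Rightarrow> nat \<Rightarrow> real" where
  "vp_coeff n m j = (if j \<le> n - m then 1 else (real n + real m - real j) / (2 * real m))"

definition vp_fundamental :: "chebyshev \<Rightarrow> nat \<Rightarrow> nat \<Rightarrow> nat \<Rightarrow> real \<Rightarrow> real" where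
  "vp_fundamental w n m k x =
     christoffel w n k *
       (\<Sum>j=0..n+m-1. vp_coeff n m j * cheb_poly w j x * cheb_poly w j (cheb_zero w n k))"

definition vp_operator :: "chebyshev \<Rightarrow> nat \<Rightarrow> nat \<Rightarrow> (real \<Rightarrow> real) \<Rightarrow> real \<Rightarrow> real" where
  "vp_operator w n m f x = (\<Sum>k=1..n. f (cheb_zero w n k) * vp_fundamental w n m k x)"

text \<open>The case distinctions implement the convention \<open>0\<^sup>0 = 1\<close>, whereas \<open>0 powr 0 = 0\<close>:
  a zero exponent must give the constant factor \<open>1\<close> also at the endpoint.\<close>

definition jacobi_weight :: "real \<Rightarrow> real \<Rightarrow> real \<Rightarrow> real" where
  "jacobi_weight \<gamma> \<delta> x =
     (if \<gamma> = 0 then 1 else (1 - x) powr \<gamma>) * (if \<delta> = 0 then 1 else (1 + x) powr \<delta>)"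

definition sup_norm :: "(real \<Rightarrow> real) \<Rightarrow> ereal" where
  "sup_norm g = (SUP x\<in>{-1..1}. ereal \<bar>g x\<bar>)"

text \<open>Functions are total here. At an endpoint where \<open>u\<close> vanishes the product \<open>f x * u x\<close> is
  \<open>0\<close> whatever the value of \<open>f\<close> there, so that value is irrelevant; values outside \<open>[-1, 1]\<close>
  never enter.\<close>

definition admissible :: "(real \<Rightarrow> real) \<Rightarrow> (real \<Rightarrow> real) \<Rightarrow> bool" where
  "admissible u f \<longleftrightarrow>
     (u 1 = 0 \<longrightarrow> ((\<lambda>x. f x * u x) \<longlongrightarrow> 0) (at_left 1)) \<and>
     (u (-1) = 0 \<longrightarrow> ((\<lambda>x. f x * u x) \<longlongrightarrow> 0) (at_right (-1)))"

definition lebesgue_const :: "chebyshev \<Rightarrow> (real \<Rightarrow> real) \<Rightarrow> nat \<Rightarrow> nat \<Rightarrow> ereal" where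
  "lebesgue_const w u n m =
     (SUP f\<in>{f. admissible u f \<and> 0 < sup_norm (\<lambda>x. f x * u x) \<and> sup_norm (\<lambda>x. f x * u x) < \<infinity>}.
        sup_norm (\<lambda>x. vp_operator w n m f x * u x) / sup_norm (\<lambda>x. f x * u x))"

end

theory Submission imports Defs begin

text \<open>Put \<open>x = cos t\<close>. Each of the four orthonormal systems becomes a pure cosine or sine system: up to a
constant, \<open>p\<^sub>j (cos t)\<close> times the square root of the transplanted weight is \<open>cos ((j + h) t)\<close> or
\<open>sin ((j + h) t)\<close>, where the shift \<open>h\<close> is \<open>0\<close>, \<open>1/2\<close> or \<open>1\<close> (\<open>cheb_basis_cos\<close>). With \<open>\<nu> = n + h\<close> the
de la Vallee Poussin sum has the closed form \<open>K(\<theta>) = sin (\<nu> \<theta>) sin (m \<theta>) / (4 m sin\<^sup>2 (\<theta>/2))\<close>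
(\<open>vp_kernel_closed\<close>), and \<open>\<bar>\<Phi>\<^sub>k (cos t)\<bar>\<close> is \<open>\<bar>K(t - \<tau>\<^sub>k) \<plusminus> K(t + \<tau>\<^sub>k)\<bar> / \<nu>\<close>, called the profile below, times
the quotient of the root densities at the node angle \<open>\<tau>\<^sub>k\<close> and at \<open>t\<close> (\<open>vp_fundamental_cos\<close>). That quotient
merges with the Jacobi weight. If \<open>e\<close>, \<open>e'\<close> in \<open>{0, 1}\<close> tell whether \<open>sin (t/2)\<close>, \<open>cos (t/2)\<close> occur in the
root density, then with \<open>\<alpha> = 2 \<gamma> - e\<close> and \<open>\<beta> = 2 \<delta> - e'\<close> the Lebesgue constant is the supremum over
\<open>0 < t < \<pi>\<close> of
\<open>\<Sum>\<^sub>k (sin (t/2) / sin (\<tau>\<^sub>k/2))\<^sup>\<alpha> (cos (t/2) / cos (\<tau>\<^sub>k/2))\<^sup>\<beta> profile\<^sub>k(t)\<close>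
(\<open>lebesgue_const_le\<close>, \<open>lebesgue_const_ge\<close>). All four weights are then covered by one statement: the
constants are bounded if and only if \<open>-1 < \<alpha> \<le> 2\<close>, \<open>-1 < \<beta> \<le> 2\<close> and \<open>\<bar>\<alpha> - \<beta>\<bar> \<le> 2\<close>
(\<open>vp_uniformly_bounded_iff\<close>).

For sufficiency, write \<open>d = \<bar>sin ((t - \<tau>\<^sub>k)/2)\<bar>\<close>. The profile is at most \<open>4\<close> and at most a constant times
\<open>\<bar>S\<bar> / (\<nu> d)\<^sup>2\<close>, where \<open>S\<close> is the value \<open>sin (\<nu> t)\<close> or \<open>cos (\<nu> t)\<close> of the system at frequency \<open>\<nu>\<close>. Near the
node the weight quotients are bounded, and the terms \<open>1 / (1 + (\<nu> d)\<^sup>2)\<close> have a bounded sum because the node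
angles have spacing \<open>\<pi>/\<nu>\<close>. Far from the node a quotient with exponent at most \<open>2\<close> is paid for by \<open>d\<^sup>-\<^sup>2\<close>; a
quotient with negative exponent is paid for by \<open>S\<close>, which vanishes at the endpoint concerned. What remains
is summable over \<open>k\<close> since the exponents exceed \<open>-1\<close> (\<open>two_sided_bound\<close>). The condition on
\<open>\<alpha> - \<beta>\<close> appears when \<open>t\<close> and the node are at opposite ends.

For necessity, take \<open>n = 2 (Q + 1) j\<close> and \<open>m = 2 Q j\<close> with \<open>Q\<close> fixed and so large that \<open>n \<le> C m\<close>. If
\<open>sin (m t) = 0\<close>, the contributions of the two kernels to the profile have the same sign, so there is no cancellation
(\<open>vp_profile_lower\<close>). Depending on the violated condition one evaluates at \<open>t = \<pi>/2\<close> or at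
\<open>t = \<pi> - \<pi>/m\<close>, where the term \<open>k = 1\<close> grows like \<open>\<nu>\<^bsup>\<alpha> - 2\<^esup>\<close> or \<open>\<nu>\<^bsup>\<alpha> - \<beta> - 2\<^esup>\<close>, or, for \<open>\<alpha> = -1\<close>, at
\<open>t = \<pi>/m\<close>, where the terms dominate \<open>\<bar>sin (k \<phi>)\<bar> / k\<close> and the sum grows logarithmically. The remaining
conditions follow by the reflection \<open>t \<mapsto> \<pi> - t\<close>, which exchanges the third and the fourth weight.\<close>

section \<open>Chebyshev polynomials in the angle variable\<close>

fun sin_exp :: "chebyshev \<Rightarrow> nat" where
  "sin_exp W1 = 0" | "sin_exp W2 = 1" | "sin_exp W3 = 0" | "sin_exp W4 = 1"

fun cos_exp :: "chebyshev \<Rightarrow> nat" where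
  "cos_exp W1 = 0" | "cos_exp W2 = 1" | "cos_exp W3 = 1" | "cos_exp W4 = 0"

text \<open>The orthonormal polynomial of degree \<open>j\<close> oscillates in \<open>t\<close> with frequency \<open>j + half_shift w\<close>.\<close>

definition half_shift :: "chebyshev \<Rightarrow> real" where
  "half_shift w = (real (sin_exp w) + real (cos_exp w)) / 2"

text \<open>Sine for the weights that vanish at \<open>x = 1\<close> (\<open>W2\<close>, \<open>W4\<close>), cosine for the others.\<close>

definition osc :: "chebyshev \<Rightarrow> real \<Rightarrow> real" where
  "osc w x = (if sin_exp w = 0 then cos x else sin x)"

text \<open>A square root of the density \<open>w (cos t) sin t\<close> of the weight in the angle variable (lemma
\<open>weight_density\<close>); its two factors vanish at \<open>x = 1\<close> and at \<open>x = -1\<close> respectively.\<close>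

definition root_density :: "chebyshev \<Rightarrow> real \<Rightarrow> real" where
  "root_density w t = (sqrt 2 * sin (t/2)) ^ sin_exp w * (sqrt 2 * cos (t/2)) ^ cos_exp w"

lemma root_density_pos: "0 < t \<Longrightarrow> t < pi \<Longrightarrow> root_density w t > 0"
  unfolding root_density_def
  by (intro mult_pos_pos zero_less_power) (auto intro!: sin_gt_zero cos_gt_zero)

lemma sin_cos_half: "sin (t::real) = 2 * sin (t/2) * cos (t/2)"
  using sin_double[of "t/2"] by simp

lemma cos_half1: "cos (t::real) = 2 * (cos (t/2))\<^sup>2 - 1"
  using cos_double_cos[of "t/2"] by simp

lemma cos_half2: "cos (t::real) = 1 - 2 * (sin (t/2))\<^sup>2"
  using cos_double_sin[of "t/2"] by simp

lemma weight_density: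
  assumes "0 < t" "t < pi"
  shows "cheb_weight w (cos t) * sin t = (root_density w t)\<^sup>2"
proof -
  have s: "sin t > 0" "sin (t/2) > 0" "cos (t/2) > 0"
    using assms by (auto intro!: sin_gt_zero cos_gt_zero)
  have q: "sqrt (1 - (cos t)\<^sup>2) = sin t"
    using s by (simp add: cos_squared_eq)
  have p: "1 + cos t = 2 * (cos (t/2))\<^sup>2" "1 - cos t = 2 * (sin (t/2))\<^sup>2"
    using cos_half1[of t] cos_half2[of t] by auto
  show ?thesis
  proof (cases w)
    case W1 then show ?thesis using s q by (simp add: root_density_def)
  next
    case W2 then show ?thesis using s q
      by (simp add: root_density_def sin_cos_half[of t] power_mult_distrib) (simp add: power2_eq_square)
  next
    case W3 then show ?thesis using s q
      by (simp add: root_density_def p real_sqrt_divide real_sqrt_mult power_mult_distrib)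
         (simp add: sin_cos_half[of t] power2_eq_square)
  next
    case W4 then show ?thesis using s q
      by (simp add: root_density_def p real_sqrt_divide real_sqrt_mult power_mult_distrib)
         (simp add: sin_cos_half[of t] power2_eq_square)
  qed
qed

text \<open>All four classical families satisfy the recurrence \<open>p\<^sub>j\<^sub>+\<^sub>2 = 2 x p\<^sub>j\<^sub>+\<^sub>1 - p\<^sub>j\<close> and differ only in their
first two members. The starting values include the factor \<open>1 / sqrt 2\<close> that makes the identity of
\<open>cheb_basis_cos\<close> hold without any constant.\<close>

fun cheb_basis :: "chebyshev \<Rightarrow> nat \<Rightarrow> real poly" where
  "cheb_basis w 0 = [: if sin_exp w = cos_exp w then 1 else 1 / sqrt 2 :]"
| "cheb_basis w (Suc 0) = (case w of W1 \<Rightarrow> [:0, 1:] | W2 \<Rightarrow> [:0, 2:]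
     | W3 \<Rightarrow> smult (1 / sqrt 2) [:-1, 2:] | W4 \<Rightarrow> smult (1 / sqrt 2) [:1, 2:])"
| "cheb_basis w (Suc (Suc j)) = smult 2 (pCons 0 (cheb_basis w (Suc j))) - cheb_basis w j"

lemma osc_three_term: "osc w (x + y) + osc w (x - y) = 2 * cos y * osc w x"
  by (simp add: osc_def sin_add sin_diff cos_add cos_diff)

text \<open>The recurrence of the polynomials is the three-term relation of \<open>cos\<close> and \<open>sin\<close>.\<close>

lemma cheb_basis_cos:
  "poly (cheb_basis w j) (cos t) * root_density w t = osc w ((real j + half_shift w) * t)"
proof (induction w j rule: cheb_basis.induct)
  case (1 w)
  then show ?case
    by (cases w) (auto simp: root_density_def osc_def half_shift_def sin_cos_half[of t] field_simps)
next
  case (2 w)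
  have t: "3 * t / 2 = t + t/2" "t * 3 / 2 = t + t/2" "t * 2 = t + t" by simp_all
  have a: "sin (3*t/2) = sin (t/2) * (1 + 2 * cos t)"
    unfolding t sin_add by (simp add: cos_half1[of t] sin_cos_half[of t] power2_eq_square algebra_simps)
  have b: "cos (3*t/2) = cos (t/2) * (2 * cos t - 1)"
    unfolding t cos_add
    by (simp add: cos_half2[of t] sin_cos_half[of t] power2_eq_square algebra_simps)
  show ?case
  proof (cases w)
    case W1 then show ?thesis by (simp add: root_density_def osc_def half_shift_def)
  next
    case W2 then show ?thesis
      by (simp add: root_density_def osc_def half_shift_def sin_double) (simp add: sin_cos_half[of t])
  next
    case W3
    then have e: "(real (Suc 0) + half_shift w) * t = 3 * t / 2"
      by (simp add: half_shift_def)
    show ?thesis unfolding e using W3 b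
      by (simp add: root_density_def osc_def algebra_simps)
  next
    case W4
    then have e: "(real (Suc 0) + half_shift w) * t = 3 * t / 2"
      by (simp add: half_shift_def)
    show ?thesis unfolding e using W4 a
      by (simp add: root_density_def osc_def algebra_simps)
  qed
next
  case (3 w j)
  have "poly (cheb_basis w (Suc (Suc j))) (cos t) * root_density w t
     = 2 * cos t * (poly (cheb_basis w (Suc j)) (cos t) * root_density w t)
       - poly (cheb_basis w j) (cos t) * root_density w t"
    by (simp add: algebra_simps)
  also have "\<dots> = osc w ((real (Suc (Suc j)) + half_shift w) * t)"
    unfolding 3 using osc_three_term[of w "(real (Suc j) + half_shift w) * t" t]
    by (simp add: algebra_simps)
  finally show ?case .
qed

lemma cheb_basis_degree:
  "degree (cheb_basis w j) = j \<and> lead_coeff (cheb_basis w j) > 0"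
proof (induction w j rule: cheb_basis.induct)
  case (1 w) then show ?case by simp
next
  case (2 w) then show ?case by (cases w) auto
next
  case (3 w j)
  let ?a = "smult 2 (pCons 0 (cheb_basis w (Suc j)))" and ?b = "- cheb_basis w j"
  have nz: "cheb_basis w (Suc j) \<noteq> 0" using 3 by fastforce
  then have d: "degree ?a = Suc (Suc j)" using 3 by (simp add: degree_pCons_eq)
  have "degree ?b < degree ?a" using d 3 by simp
  then have "degree (?a + ?b) = degree ?a" "lead_coeff (?a + ?b) = lead_coeff ?a"
    by (rule degree_add_eq_left, metis add.commute lead_coeff_add_le)
  then show ?case using d 3 nz by (metis lead_coeff_pCons(1) lead_coeff_smult mult_pos_pos diff_conv_add_uminus cheb_basis.simps(3) zero_less_numeral)
qed

text \<open>Over \<open>[0, \<pi>]\<close> the constant function \<open>1\<close> has twice the square integral of the other functions of the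
system; it occurs only for the weight \<open>W1\<close> and degree \<open>0\<close>.\<close>

definition cheb_orthonormal :: "chebyshev \<Rightarrow> nat \<Rightarrow> real poly" where
  "cheb_orthonormal w j =
     smult (if w = W1 \<and> j = 0 then sqrt (1 / pi) else sqrt (2 / pi)) (cheb_basis w j)"

lemma cheb_orthonormal_degree:
  "degree (cheb_orthonormal w j) = j" "lead_coeff (cheb_orthonormal w j) > 0"
  using cheb_basis_degree[of w j] by (auto simp: cheb_orthonormal_def)

text \<open>Successive elimination of the leading coefficient, using that \<open>p\<close> contains one polynomial of each degree.\<close>

lemma poly_degree_expansion:
  fixes p :: "nat \<Rightarrow> 'a::field poly"
  assumes deg: "\<And>i. degree (p i) = i" and nz: "\<And>i. p i \<noteq> 0"
    and r: "\<And>i. n \<le> i \<Longrightarrow> coeff r i = 0"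
  shows "\<exists>a. r = (\<Sum>i<n. smult (a i) (p i))"
  using r
proof (induction n arbitrary: r)
  case 0 then show ?case by (simp add: poly_eqI)
next
  case (Suc n)
  define c where "c = coeff r n / lead_coeff (p n)"
  have "coeff (r - smult c (p n)) i = 0" if "n \<le> i" for i
  proof (cases "i = n")
    case True
    have "coeff (p n) n \<noteq> 0" using deg[of n] nz[of n] by (metis leading_coeff_0_iff)
    then show ?thesis using True deg[of n] by (simp add: c_def)
  next
    case False
    then show ?thesis using that Suc.prems[of i] deg[of n] by (simp add: coeff_eq_0)
  qed
  then obtain a where a: "r - smult c (p n) = (\<Sum>i<n. smult (a i) (p i))" using Suc.IH by blast
  have "(\<Sum>i<n. smult ((a(n := c)) i) (p i)) = (\<Sum>i<n. smult (a i) (p i))"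
    by (intro sum.cong) auto
  then have "r = (\<Sum>i<Suc n. smult ((a(n := c)) i) (p i))" using a by (simp add: algebra_simps)
  then show ?case by blast
qed

section \<open>Orthonormality and uniqueness\<close>

text \<open>By induction the two systems agree below degree \<open>n\<close>. Subtracting from \<open>q n\<close> the multiple of \<open>p n\<close> with
the same leading coefficient leaves a combination of \<open>p 0, \<dots>, p (n - 1)\<close> which is orthogonal to each of
them, hence zero; the norm and the sign of the leading coefficient fix the multiple to be \<open>1\<close>.\<close>

lemma orthonormal_system_unique:
  fixes w :: "real \<Rightarrow> real"
  assumes int: "\<And>r. set_integrable lborel {-1<..<1} (\<lambda>x. poly r x * w x)"
    and P: "orthonormal_system w p" and Q: "orthonormal_system w q"
  shows "q = p"
proof -
  define J where "J r = (LBINT x:{-1<..<1}. poly r x * w x)" for r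
  have J_add: "J (r + s) = J r + J s" for r s
    unfolding J_def using set_integral_add(2)[OF int int, of r s] by (simp add: algebra_simps)
  have J_smult: "J (smult c r) = c * J r" for c r
    unfolding J_def by (simp add: mult.assoc)
  have J_sum: "J (\<Sum>i\<in>A. f i) = (\<Sum>i\<in>A. J (f i))" if "finite A" for A :: "nat set" and f
    using that by (induction A) (simp_all add: J_add, simp add: J_def)
  have deg: "degree (p i) = i" "lead_coeff (p i) > 0" "degree (q i) = i" "lead_coeff (q i) > 0" for i
    using P[unfolded orthonormal_system_def, THEN conjunct1, rule_format, of i]
      Q[unfolded orthonormal_system_def, THEN conjunct1, rule_format, of i] by auto
  have Jp: "J (p i * p j) = (if i = j then 1 else 0)" and Jq: "J (q i * q j) = (if i = j then 1 else 0)" for i j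
    using P Q by (auto simp: orthonormal_system_def J_def)
  have p0: "p i \<noteq> 0" for i using deg(2)[of i] by auto
  have "q n = p n" for n
  proof (induction n rule: less_induct)
    case (less n)
    define c where "c = lead_coeff (q n) / lead_coeff (p n)"
    have c: "c > 0" unfolding c_def using deg by simp
    define r where "r = q n - smult c (p n)"
    have "coeff r i = 0" if "n \<le> i" for i
    proof (cases "i = n")
      case True then show ?thesis using deg(1,3)[of n] deg(2)[of n] by (simp add: r_def c_def)
    next
      case False then show ?thesis using that deg(1,3)[of n] by (simp add: r_def coeff_eq_0)
    qed
    then obtain a where a: "r = (\<Sum>i<n. smult (a i) (p i))"
      using poly_degree_expansion[of p n r] deg(1) p0 by blast
    have "a i = 0" if "i < n" for i
    proof -
      have "J (r * p i) = (\<Sum>j<n. a j * J (p j * p i))"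
        unfolding a sum_distrib_right by (simp add: J_sum J_smult)
      also have "\<dots> = (\<Sum>j<n. if j = i then a j else 0)" by (intro sum.cong) (auto simp: Jp)
      also have "\<dots> = a i" using that by simp
      finally have "J (r * p i) = a i" .
      moreover have "r * p i = q n * q i + smult (-c) (p n * p i)"
        using less.IH[OF that] by (simp add: r_def algebra_simps)
      ultimately show ?thesis using that by (simp add: J_add J_smult Jp Jq del: smult_minus_left)
    qed
    then have "r = 0" using a by simp
    then have qn: "q n = smult c (p n)" by (simp add: r_def)
    have "1 = J (q n * q n)" by (simp add: Jq)
    also have "\<dots> = c * c" unfolding qn by (simp add: J_smult Jp)
    finally have "c = 1" using c square_eq_1_iff[of c] by auto
    then show ?case using qn by simp
  qed
  then show ?thesis by auto
qed

lemma has_integral_cos_int: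
  "((\<lambda>t. cos (of_int k * t)) has_integral (if k = 0 then pi else 0)) {0..pi}"
proof (cases "k = 0")
  case True then show ?thesis using has_integral_const_real[of "1::real" 0 pi] by simp
next
  case False
  have "((\<lambda>t. cos (of_int k * t)) has_integral (sin (of_int k * pi) / of_int k - sin (of_int k * 0) / of_int k)) {0..pi}"
  proof (rule fundamental_theorem_of_calculus)
    fix t :: real
    have "((\<lambda>t. sin (of_int k * t) / of_int k) has_real_derivative cos (of_int k * t)) (at t within {0..pi})"
      using False by (auto intro!: derivative_eq_intros)
    then show "((\<lambda>t. sin (of_int k * t) / of_int k) has_vector_derivative cos (of_int k * t)) (at t within {0..pi})"
      by (simp add: has_real_derivative_iff_has_vector_derivative)
  qed simp
  then show ?thesis using False by (simp add: mult.commute)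
qed

definition osc_sign :: "chebyshev \<Rightarrow> real" where
  "osc_sign w = (if sin_exp w = 0 then 1 else -1)"

lemma osc_mult: "osc w x * osc w y = (cos (x - y) + osc_sign w * cos (x + y)) / 2"
  by (simp add: osc_def osc_sign_def cos_add cos_diff)

text \<open>By the product formula the integrand is a combination of \<open>cos (k t)\<close> with integers \<open>k = i - j\<close> and
\<open>k = i + j + 2 h\<close>; the second one is zero only if \<open>h = 0\<close> and \<open>i = j = 0\<close>.\<close>

lemma osc_orthogonal:
  "((\<lambda>t. osc w ((real i + half_shift w) * t) * osc w ((real j + half_shift w) * t)) has_integral
    (if i = j then if w = W1 \<and> i = 0 then pi else pi / 2 else 0)) {0..pi}"
proof -
  define e where "e = int (sin_exp w) + int (cos_exp w)"
  have e: "2 * half_shift w = of_int e" by (simp add: e_def half_shift_def)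
  let ?k = "int i - int j" and ?l = "int i + int j + e"
  have "((\<lambda>t. (cos (of_int ?k * t) + osc_sign w * cos (of_int ?l * t)) / 2) has_integral
     ((if ?k = 0 then pi else 0) + osc_sign w * (if ?l = 0 then pi else 0)) / 2) {0..pi}"
    by (intro has_integral_divide has_integral_add has_integral_mult_right has_integral_cos_int)
  moreover have "(cos (of_int ?k * t) + osc_sign w * cos (of_int ?l * t)) / 2
    = osc w ((real i + half_shift w) * t) * osc w ((real j + half_shift w) * t)" for t
    unfolding osc_mult using e by (simp add: algebra_simps flip: e)
  moreover have "((if ?k = 0 then pi else 0) + osc_sign w * (if ?l = 0 then pi else 0)) / 2
     = (if i = j then if w = W1 \<and> i = 0 then pi else pi / 2 else 0)"
    by (cases w) (auto simp: e_def osc_sign_def)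
  ultimately show ?thesis by simp
qed

lemma image_cos_open: "cos ` {0<..<pi} = {-1<..<1::real}"
proof
  show "cos ` {0<..<pi} \<subseteq> {-1<..<1::real}"
    using cos_monotone_0_pi[of 0] cos_monotone_0_pi[of _ pi] by force
  show "{-1<..<1::real} \<subseteq> cos ` {0<..<pi}"
  proof
    fix x :: real assume "x \<in> {-1<..<1}"
    then have "x = cos (arccos x)" "0 < arccos x" "arccos x < pi"
      using arccos_lt_bounded[of x] by auto
    then show "x \<in> cos ` {0<..<pi}" by (metis greaterThanLessThan_iff image_eqI)
  qed
qed

lemma cheb_weight_borel: "cheb_weight w \<in> borel_measurable borel"
proof -
  have "cheb_weight w = (case w of W1 \<Rightarrow> \<lambda>x. 1 / sqrt (1 - x\<^sup>2) | W2 \<Rightarrow> \<lambda>x. sqrt (1 - x\<^sup>2)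
    | W3 \<Rightarrow> \<lambda>x. sqrt ((1 + x) / (1 - x)) | W4 \<Rightarrow> \<lambda>x. sqrt ((1 - x) / (1 + x)))"
    by (cases w) auto
  then show ?thesis by (cases w) simp_all
qed

text \<open>Substitution of \<open>x = cos t\<close>. The weight may be unbounded at the endpoints, but after the substitution the
integrand is continuous on \<open>[0, \<pi>]\<close>, which gives integrability.\<close>

lemma cheb_integral_substitution:
  shows "set_integrable lborel {-1<..<1} (\<lambda>x. poly r x * cheb_weight w x)" (is ?int)
    and "(LBINT x:{-1<..<1}. poly r x * cheb_weight w x)
      = integral {0..pi} (\<lambda>t. poly r (cos t) * (root_density w t)\<^sup>2)" (is ?eq)
proof -
  let ?f = "\<lambda>x. poly r x * cheb_weight w x"
  let ?g = "\<lambda>t. poly r (cos t) * (root_density w t)\<^sup>2"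
  have eq: "\<bar>- sin t\<bar> * ?f (cos t) = ?g t" if "t \<in> {0<..<pi}" for t
  proof -
    have "sin t > 0" using that by (auto intro: sin_gt_zero)
    then show ?thesis using weight_density[of t w] that by (simp add: mult.commute mult.left_commute)
  qed
  have "?g absolutely_integrable_on {0..pi}"
    unfolding root_density_def by (intro absolutely_integrable_continuous_real continuous_intros) auto
  then have "?g absolutely_integrable_on {0<..<pi}"
    by (simp add: absolutely_integrable_on_Icc_iff_Ioo)
  then have ai: "(\<lambda>t. \<bar>- sin t\<bar> * ?f (cos t)) absolutely_integrable_on {0<..<pi}"
    by (subst set_integrable_cong[OF refl refl eq])
  have inj: "inj_on cos {0<..<pi}"
    by (auto intro!: inj_onI cos_inj_pi)
  have "(\<lambda>t. \<bar>- sin t\<bar> * ?f (cos t)) absolutely_integrable_on {0<..<pi} \<and>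
      integral {0<..<pi} (\<lambda>t. \<bar>- sin t\<bar> * ?f (cos t)) = integral {0<..<pi} ?g"
    using ai eq by (auto intro!: integral_cong)
  then have "?f absolutely_integrable_on (cos ` {0<..<pi}) \<and>
      integral (cos ` {0<..<pi}) ?f = integral {0<..<pi} ?g"
    by (subst (asm) has_absolute_integral_change_of_variables_1')
       (auto intro!: derivative_eq_intros inj)
  then have *: "?f absolutely_integrable_on {-1<..<1}" "integral {-1<..<1} ?f = integral {0<..<pi} ?g"
    unfolding image_cos_open by auto
  have "(\<lambda>x. indicator {-1<..<1} x *\<^sub>R ?f x) \<in> borel_measurable lborel"
    using cheb_weight_borel[of w]
    by (intro borel_measurable_scaleR borel_measurable_times borel_measurable_indicator)
       (auto intro!: borel_measurable_continuous_onI continuous_intros)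
  then show "?int"
    using *(1) unfolding set_integrable_def by (simp only: integrable_completion)
  show ?eq
    using set_borel_integral_eq_integral(2)[OF \<open>?int\<close>] *(2) by (simp add: integral_open_interval_real)
qed

lemma cheb_orthonormal_system: "orthonormal_system (cheb_weight w) (cheb_orthonormal w)"
proof -
  have "(LBINT x:{-1<..<1}. poly (cheb_orthonormal w i) x * poly (cheb_orthonormal w j) x * cheb_weight w x)
    = (if i = j then 1 else 0)" for i j
  proof -
    define k where "k i = (if w = W1 \<and> i = 0 then sqrt (1 / pi) else sqrt (2 / pi))" for i :: nat
    have "(LBINT x:{-1<..<1}. poly (cheb_orthonormal w i) x * poly (cheb_orthonormal w j) x * cheb_weight w x)
      = integral {0..pi} (\<lambda>t. poly (cheb_orthonormal w i * cheb_orthonormal w j) (cos t) * (root_density w t)\<^sup>2)"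
      unfolding cheb_integral_substitution(2)[symmetric] by simp
    also have "\<dots> = integral {0..pi} (\<lambda>t. k i * k j *
        (osc w ((real i + half_shift w) * t) * osc w ((real j + half_shift w) * t)))"
      by (intro integral_cong)
         (simp add: cheb_orthonormal_def k_def power2_eq_square flip: cheb_basis_cos)
    also have "\<dots> = k i * k j * (if i = j then if w = W1 \<and> i = 0 then pi else pi / 2 else 0)"
      by (intro integral_unique has_integral_mult_right osc_orthogonal)
    also have "\<dots> = (if i = j then 1 else 0)" by (auto simp: k_def)
    finally show ?thesis .
  qed
  then have orth: "\<forall>i j. (LBINT x:{-1<..<1}. poly (cheb_orthonormal w i) x * poly (cheb_orthonormal w j) x
    * cheb_weight w x) = (if i = j then 1 else 0)"
    by (intro allI)
  show ?thesis unfolding orthonormal_system_def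
    by (intro conjI allI cheb_orthonormal_degree orth[rule_format])
qed

lemma orthonormal_poly_cheb: "orthonormal_poly (cheb_weight w) = cheb_orthonormal w"
  unfolding orthonormal_poly_def
  by (rule the_equality, rule cheb_orthonormal_system)
    (rule orthonormal_system_unique[OF cheb_integral_substitution(1) cheb_orthonormal_system])

section \<open>Nodes and Christoffel numbers\<close>

text \<open>The zeros \<open>cos t\<close> of \<open>p\<^sub>n\<close> are given by the zeros \<open>t\<close> of \<open>osc w (freq w n * t)\<close> in \<open>(0, \<pi>)\<close>.\<close>

definition freq :: "chebyshev \<Rightarrow> nat \<Rightarrow> real" where
  "freq w n = real n + half_shift w"

lemma half_shift_cases: "half_shift w \<in> {0, 1/2, 1}"
  by (cases w) (auto simp: half_shift_def)

lemma freq_bounds: "real n \<le> freq w n" "freq w n \<le> real n + 1"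
  using half_shift_cases[of w] by (auto simp: freq_def)

lemma cheb_angle_eq:
  "cheb_angle w n k = (2 * real k - 1 + real (sin_exp w)) * pi / (2 * freq w n)"
  by (cases w) (auto simp: freq_def half_shift_def field_simps)

lemma cheb_angle_reflect:
  assumes "n > 0"
  shows "pi - cheb_angle w n k = (2 * (real n - real k) + 1 + real (cos_exp w)) * pi / (2 * freq w n)"
  using assms freq_bounds(1)[of n w]
  by (simp add: cheb_angle_eq freq_def half_shift_def field_simps)

lemma cheb_angle_range:
  assumes "1 \<le> k" "k \<le> n"
  shows "0 < cheb_angle w n k" "cheb_angle w n k < pi"
proof -
  have f: "freq w n > 0" using assms freq_bounds(1)[of n w] by linarith
  show "0 < cheb_angle w n k"
    unfolding cheb_angle_eq using assms f by (intro divide_pos_pos mult_pos_pos) auto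
  have "0 < pi - cheb_angle w n k"
    using assms f by (subst cheb_angle_reflect) (auto intro!: divide_pos_pos mult_pos_pos)
  then show "cheb_angle w n k < pi" by simp
qed

lemma freq_angle:
  assumes "n > 0"
  shows "sin (freq w n * cheb_angle w n k) = (if sin_exp w = 0 then - ((-1) ^ k) else 0)"
    and "cos (freq w n * cheb_angle w n k) = (if sin_exp w = 0 then 0 else (-1) ^ k)"
proof -
  have f: "freq w n > 0" using assms freq_bounds(1)[of n w] by linarith
  have e: "freq w n * cheb_angle w n k = (2 * real k - 1 + real (sin_exp w)) * pi / 2"
    using f by (simp add: cheb_angle_eq)
  have c: "sin_exp w = 0 \<or> sin_exp w = 1" by (cases w) auto
  have e0: "freq w n * cheb_angle w n k = real k * pi - pi / 2" if "sin_exp w = 0"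
    unfolding e using that by (simp add: field_simps)
  have e1: "freq w n * cheb_angle w n k = real k * pi" if "sin_exp w = 1"
    unfolding e using that by (simp add: field_simps)
  show "sin (freq w n * cheb_angle w n k) = (if sin_exp w = 0 then - ((-1) ^ k) else 0)"
    "cos (freq w n * cheb_angle w n k) = (if sin_exp w = 0 then 0 else (-1) ^ k)"
    using c by (auto simp: e0 e1 sin_diff cos_diff)
qed

lemma telescope_cos:
  "2 * sin \<tau> * (\<Sum>j<n. cos ((2 * real j + c) * \<tau>)) = sin ((2 * real n + c - 1) * \<tau>) - sin ((c - 1) * \<tau>)"
proof (induction n)
  case (Suc n)
  have "2 * sin \<tau> * cos ((2 * real n + c) * \<tau>) = sin ((2 * real n + c) * \<tau> + \<tau>) - sin ((2 * real n + c) * \<tau> - \<tau>)"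
    by (simp add: sin_add sin_diff)
  then show ?case using Suc by (simp add: algebra_simps)
qed simp

text \<open>Written with the double angle the sum telescopes, and at a node \<open>2 \<nu> \<tau>\<close> is a multiple of \<open>\<pi>\<close>. For \<open>W1\<close>
the term \<open>j = 0\<close> is too large by the factor \<open>2\<close> compared with the orthonormal system, hence the correction.\<close>

lemma sum_osc_squares:
  assumes "1 \<le> k" "k \<le> n"
  shows "(\<Sum>j<n. (osc w ((real j + half_shift w) * cheb_angle w n k))\<^sup>2)
    = (freq w n + (if w = W1 then 1 else 0)) / 2"
proof -
  define \<tau> where "\<tau> = cheb_angle w n k"
  define h where "h = half_shift w"
  have s: "sin \<tau> > 0" unfolding \<tau>_def using cheb_angle_range[OF assms] by (intro sin_gt_zero)
  have n: "n > 0" using assms by simp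
  \<comment> \<open>Both boundary terms of the telescoping sum are multiples of \<open>sin \<tau>\<close>.\<close>
  have dbl: "(2 * real n + 2 * h - 1) * \<tau> = 2 * (freq w n * \<tau>) - \<tau>"
    by (simp add: freq_def h_def algebra_simps)
  have "sin ((2 * real n + 2 * h - 1) * \<tau>) = osc_sign w * sin \<tau>"
    unfolding dbl sin_diff sin_double cos_double using freq_angle[OF n, of w k]
    by (simp add: \<tau>_def osc_sign_def flip: power_mult)
  moreover have "sin ((2 * h - 1) * \<tau>) = (2 * h - 1) * sin \<tau>"
    using half_shift_cases[of w] by (cases w) (simp_all add: h_def half_shift_def)
  ultimately have "2 * sin \<tau> * (\<Sum>j<n. cos ((2 * real j + 2 * h) * \<tau>)) = (osc_sign w - 2 * h + 1) * sin \<tau>"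
    using telescope_cos[of \<tau> "2 * h" n] by (simp add: algebra_simps)
  then have "sin \<tau> * (2 * (\<Sum>j<n. cos ((2 * real j + 2 * h) * \<tau>))) = sin \<tau> * (osc_sign w - 2 * h + 1)"
    by (simp only: mult_ac)
  then have C: "(\<Sum>j<n. cos ((2 * real j + 2 * h) * \<tau>)) = (osc_sign w - 2 * h + 1) / 2"
    using s unfolding mult_cancel_left by (auto simp: field_simps)
  have "(\<Sum>j<n. (osc w ((real j + h) * \<tau>))\<^sup>2)
      = (\<Sum>j<n. 1/2 + osc_sign w / 2 * cos ((2 * real j + 2 * h) * \<tau>))"
    unfolding power2_eq_square osc_mult by (intro sum.cong) (simp_all add: algebra_simps add_divide_distrib)
  also have "\<dots> = real n / 2 + osc_sign w / 2 * (\<Sum>j<n. cos ((2 * real j + 2 * h) * \<tau>))"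
    by (simp add: sum.distrib sum_distrib_left)
  also have "\<dots> = (freq w n + (if w = W1 then 1 else 0)) / 2"
    unfolding C by (cases w) (simp_all add: h_def freq_def half_shift_def osc_sign_def field_simps)
  finally show ?thesis by (simp add: \<tau>_def h_def)
qed

lemma cheb_poly_cos:
  assumes "0 < t" "t < pi"
  shows "cheb_poly w j (cos t) = (if w = W1 \<and> j = 0 then sqrt (1 / pi) else sqrt (2 / pi))
     * osc w ((real j + half_shift w) * t) / root_density w t"
  using root_density_pos[OF assms, of w]
  by (simp add: orthonormal_poly_cheb cheb_orthonormal_def flip: cheb_basis_cos)

text \<open>The summand of degree \<open>n\<close> vanishes at the node, so \<open>sum_osc_squares\<close> evaluates the sum.\<close>

lemma christoffel_eq:
  assumes "1 \<le> k" "k \<le> n"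
  shows "christoffel w n k = pi / freq w n * (root_density w (cheb_angle w n k))\<^sup>2"
proof -
  define \<tau> where "\<tau> = cheb_angle w n k"
  define o2 where "o2 j = (osc w ((real j + half_shift w) * \<tau>))\<^sup>2" for j
  note r = cheb_angle_range[OF assms, of w, folded \<tau>_def]
  have E: "root_density w \<tau> > 0" using r by (rule root_density_pos)
  have n: "n > 0" using assms by simp
  have last: "o2 n = 0"
    using freq_angle[OF n, of w k] by (simp add: o2_def \<tau>_def freq_def osc_def)
  have first: "o2 0 = 1" if "w = W1" using that by (simp add: o2_def osc_def half_shift_def)
  have "(\<Sum>j=0..n. (cheb_poly w j (cos \<tau>))\<^sup>2)
     = (\<Sum>j\<in>insert n {..<n}. ((if w = W1 \<and> j = 0 then 1 else 2) / pi) * o2 j / (root_density w \<tau>)\<^sup>2)"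
    using r by (intro sum.cong) (auto simp: cheb_poly_cos o2_def power_divide power_mult_distrib)
  also have "\<dots> = (\<Sum>j<n. ((if w = W1 \<and> j = 0 then 1 else 2) / pi) * o2 j) / (root_density w \<tau>)\<^sup>2"
    using last by (simp add: sum_divide_distrib)
  also have "(\<Sum>j<n. ((if w = W1 \<and> j = 0 then 1 else 2) / pi) * o2 j)
     = (\<Sum>j<n. (2 / pi) * o2 j - (if j = 0 then if w = W1 then 1 / pi else 0 else 0))"
    using first by (intro sum.cong) (auto simp: field_simps)
  also have "\<dots> = (2 / pi) * (\<Sum>j<n. o2 j) - (if w = W1 then 1 / pi else 0)"
    using n by (simp add: sum_subtractf sum_distrib_left)
  also have "(\<Sum>j<n. o2 j) = (freq w n + (if w = W1 then 1 else 0)) / 2"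
    unfolding o2_def \<tau>_def by (rule sum_osc_squares[OF assms])
  also have "(2 / pi) * ((freq w n + (if w = W1 then 1 else 0)) / 2) - (if w = W1 then 1 / pi else 0) = freq w n / pi"
    by (simp add: field_simps)
  finally show ?thesis by (simp add: christoffel_def cheb_zero_def \<tau>_def)
qed

section \<open>The de la Vallee Poussin kernel\<close>

text \<open>The ramp \<open>min M (a + M - j)\<close> counts the partial sums that contain \<open>f j\<close>. It turns the de la Vallee Poussin
coefficients into an average of \<open>2 m\<close> consecutive partial sums.\<close>

lemma sum_partial_sums:
  fixes f :: "nat \<Rightarrow> real"
  shows "(\<Sum>N=a..<a+M. \<Sum>j\<le>N. f j) = (\<Sum>j<a+M. real (min M (a + M - j)) * f j)"
proof (induction M)
  case (Suc M)
  have "(\<Sum>j<a + Suc M. real (min (Suc M) (a + Suc M - j)) * f j)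
     = (\<Sum>j<a + Suc M. real (min M (a + M - j)) * f j + f j)"
    by (intro sum.cong) (auto simp: min_def algebra_simps Suc_diff_le)
  also have "\<dots> = (\<Sum>j<a+M. real (min M (a + M - j)) * f j) + (\<Sum>j\<le>a+M. f j)"
    by (simp add: sum.distrib flip: lessThan_Suc_atMost)
  finally show ?case using Suc by simp
qed simp

text \<open>The constant \<open>h - 1/2\<close> halves the term \<open>j = 0\<close> if \<open>h = 0\<close>, and it supplies the missing term
of frequency \<open>0\<close> if \<open>h = 1\<close>; this is what makes the closed form below uniform in the weight.\<close>

definition vp_kernel :: "chebyshev \<Rightarrow> nat \<Rightarrow> nat \<Rightarrow> real \<Rightarrow> real" where
  "vp_kernel w n m \<theta> =
     (\<Sum>j=0..n+m-1. vp_coeff n m j * cos ((real j + half_shift w) * \<theta>)) + half_shift w - 1/2"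

lemma telescope_dirichlet:
  "2 * sin (\<theta>/2) * (\<Sum>j\<le>N. cos ((real j + h) * \<theta>)) = sin ((real N + h + 1/2) * \<theta>) - sin ((h - 1/2) * \<theta>)"
  using telescope_cos[of "\<theta>/2" "2 * h" "Suc N"]
  by (simp add: lessThan_Suc_atMost algebra_simps)

lemma telescope_fejer:
  "2 * sin (\<theta>/2) * (\<Sum>N=a..<a+M. sin ((real N + h + 1/2) * \<theta>))
    = cos ((real a + h) * \<theta>) - cos ((real (a + M) + h) * \<theta>)"
proof (induction M)
  case (Suc M)
  let ?x = "(real (a + M) + h + 1/2) * \<theta>"
  have "2 * sin (\<theta>/2) * sin ?x = cos (?x - \<theta>/2) - cos (?x + \<theta>/2)"
    by (simp add: cos_add cos_diff)
  also have "?x - \<theta>/2 = (real (a + M) + h) * \<theta>" by (simp add: algebra_simps)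
  also have "?x + \<theta>/2 = (real (a + Suc M) + h) * \<theta>" by (simp add: algebra_simps)
  finally show ?case using Suc by (simp add: distrib_left)
qed simp

text \<open>The average of partial sums is summed by telescoping twice, each time after multiplication by
\<open>2 sin (\<theta>/2)\<close>. Keeping the denominator on the left makes the identity valid for every \<open>\<theta>\<close>.\<close>

lemma vp_kernel_closed:
  assumes "0 < m" "m < n"
  shows "vp_kernel w n m \<theta> * (4 * real m * (sin (\<theta>/2))\<^sup>2) = sin (freq w n * \<theta>) * sin (real m * \<theta>)"
proof -
  define h where "h = half_shift w"
  define f where "f j = cos ((real j + h) * \<theta>)" for j
  define s where "s = sin (\<theta>/2)"
  define a where "a = n - m"
  have set: "{0..n+m-1} = {..<a + 2*m}" using assms by (auto simp: a_def)
  have "2 * real m * (\<Sum>j=0..n+m-1. vp_coeff n m j * f j) = (\<Sum>j<a + 2*m. real (min (2*m) (a + 2*m - j)) * f j)"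
    unfolding set sum_distrib_left
    using assms by (intro sum.cong) (auto simp: vp_coeff_def a_def min_def of_nat_diff)
  also have "\<dots> = (\<Sum>N=a..<a+2*m. \<Sum>j\<le>N. f j)" by (rule sum_partial_sums[symmetric])
  finally have A: "2 * real m * (\<Sum>j=0..n+m-1. vp_coeff n m j * f j) = (\<Sum>N=a..<a+2*m. \<Sum>j\<le>N. f j)" .
  have "2 * s * (\<Sum>N=a..<a+2*m. \<Sum>j\<le>N. f j) = (\<Sum>N=a..<a+2*m. sin ((real N + h + 1/2) * \<theta>) - sin ((h - 1/2) * \<theta>))"
    unfolding sum_distrib_left s_def f_def telescope_dirichlet[unfolded sum_distrib_left] ..
  also have "\<dots> = (\<Sum>N=a..<a+2*m. sin ((real N + h + 1/2) * \<theta>)) - 2 * real m * sin ((h - 1/2) * \<theta>)"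
    by (simp add: sum_subtractf)
  finally have "2 * s * (2 * s * (\<Sum>N=a..<a+2*m. \<Sum>j\<le>N. f j))
     = cos ((real a + h) * \<theta>) - cos ((real (a + 2*m) + h) * \<theta>) - 4 * real m * s * sin ((h - 1/2) * \<theta>)"
    using telescope_fejer[where \<theta> = \<theta> and a = a and M = "2*m" and h = h] by (simp add: s_def right_diff_distrib)
  also have "(real a + h) * \<theta> = freq w n * \<theta> - real m * \<theta>"
    using assms by (simp add: a_def freq_def h_def of_nat_diff algebra_simps)
  also have "(real (a + 2*m) + h) * \<theta> = freq w n * \<theta> + real m * \<theta>"
    using assms by (simp add: a_def freq_def h_def of_nat_diff algebra_simps)
  also have "sin ((h - 1/2) * \<theta>) = (2 * h - 1) * s"
    by (cases w) (simp_all add: h_def s_def half_shift_def)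
  finally have "4 * s\<^sup>2 * (\<Sum>N=a..<a+2*m. \<Sum>j\<le>N. f j)
     = 2 * sin (freq w n * \<theta>) * sin (real m * \<theta>) - 4 * real m * s\<^sup>2 * (2 * h - 1)"
    by (simp add: power2_eq_square cos_diff cos_add mult.assoc)
  then show ?thesis
    unfolding A[symmetric] vp_kernel_def h_def[symmetric] f_def[symmetric] s_def[symmetric]
    by (simp add: algebra_simps)
qed

lemma vp_kernel_bound:
  assumes "0 < m" "m < n"
  shows "\<bar>vp_kernel w n m \<theta>\<bar> \<le> 2 * freq w n"
proof -
  have "\<bar>\<Sum>j=0..n+m-1. vp_coeff n m j * cos ((real j + half_shift w) * \<theta>)\<bar> \<le> (\<Sum>j=0..n+m-1. 1)"
  proof (rule order.trans[OF sum_abs], rule sum_mono)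
    fix j assume "j \<in> {0..n+m-1}"
    then have "j \<le> n + m" by auto
    then have "0 \<le> vp_coeff n m j" "vp_coeff n m j \<le> 1"
      using assms by (auto simp: vp_coeff_def field_simps)
    then show "\<bar>vp_coeff n m j * cos ((real j + half_shift w) * \<theta>)\<bar> \<le> 1"
      by (auto simp: abs_mult intro!: mult_le_one)
  qed
  also have "(\<Sum>j=0..n+m-1. 1::real) = real (n + m)" using assms by simp
  finally have "\<bar>\<Sum>j=0..n+m-1. vp_coeff n m j * cos ((real j + half_shift w) * \<theta>)\<bar> \<le> real (n + m)" .
  moreover have "real m + 1 \<le> real n" using assms by linarith
  moreover have "\<bar>half_shift w - 1/2\<bar> \<le> 1/2" using half_shift_cases[of w] by auto
  ultimately show ?thesis
    unfolding vp_kernel_def using freq_bounds(1)[of n w] of_nat_add[of n m, where ?'a = real] by linarith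
qed

definition vp_profile :: "chebyshev \<Rightarrow> nat \<Rightarrow> nat \<Rightarrow> nat \<Rightarrow> real \<Rightarrow> real" where
  "vp_profile w n m k t =
     \<bar>vp_kernel w n m (t - cheb_angle w n k) + osc_sign w * vp_kernel w n m (t + cheb_angle w n k)\<bar> / freq w n"

text \<open>Each product of two basis functions splits by the product formula into contributions to \<open>K(t - \<tau>)\<close> and
\<open>K(t + \<tau>)\<close>. The constants in the definition of the kernel cancel against the sign (sine systems), are
zero (shift \<open>1/2\<close>), or account for the exceptional normalization of \<open>p\<^sub>0\<close> (weight \<open>W1\<close>).\<close>

lemma vp_fundamental_cos:
  assumes "0 < m" "m < n" "1 \<le> k" "k \<le> n" "0 < t" "t < pi"
  shows "\<bar>vp_fundamental w n m k (cos t)\<bar> =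
    root_density w (cheb_angle w n k) / root_density w t * vp_profile w n m k t"
proof -
  define \<tau> where "\<tau> = cheb_angle w n k"
  define h where "h = half_shift w"
  define \<mu> where "\<mu> = vp_coeff n m"
  note r = cheb_angle_range[OF assms(3,4), of w, folded \<tau>_def]
  have E: "root_density w \<tau> > 0" "root_density w t > 0" using r assms by (auto intro: root_density_pos)
  have f: "freq w n > 0" using assms freq_bounds(1)[of n w] by linarith
  let ?D = "root_density w t * root_density w \<tau>"
  let ?o = "\<lambda>j. osc w ((real j + h) * t) * osc w ((real j + h) * \<tau>)"
  let ?K = "\<lambda>\<theta>. \<Sum>j=0..n+m-1. \<mu> j * cos ((real j + h) * \<theta>)"
  have o: "?o j = (cos ((real j + h) * (t - \<tau>)) + osc_sign w * cos ((real j + h) * (t + \<tau>))) / 2" for j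
    unfolding osc_mult by (simp add: algebra_simps)
  have k2: "sqrt (1 / pi) * sqrt (1 / pi) = 1 / pi" "sqrt (2 / pi) * sqrt (2 / pi) = 2 / pi" by simp_all
  have "(\<Sum>j=0..n+m-1. \<mu> j * cheb_poly w j (cos t) * cheb_poly w j (cos \<tau>))
    = (\<Sum>j=0..n+m-1. ((2 / pi) * (\<mu> j * ?o j) - (if j = 0 then if w = W1 then 1 / pi else 0 else 0)) / ?D)"
  proof (intro sum.cong refl)
    fix j
    show "\<mu> j * cheb_poly w j (cos t) * cheb_poly w j (cos \<tau>)
       = ((2 / pi) * (\<mu> j * ?o j) - (if j = 0 then if w = W1 then 1 / pi else 0 else 0)) / ?D"
    proof (cases "w = W1 \<and> j = 0")
      case True
      then have "\<mu> j = 1" "osc w ((real j + h) * t) = 1" "osc w ((real j + h) * \<tau>) = 1"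
        by (auto simp: \<mu>_def vp_coeff_def osc_def h_def half_shift_def)
      then show ?thesis
        unfolding cheb_poly_cos[OF r] cheb_poly_cos[OF assms(5,6)] h_def[symmetric] if_P[OF True]
        using True by (simp add: root_density_def)
    next
      case False
      have "\<mu> j * cheb_poly w j (cos t) * cheb_poly w j (cos \<tau>)
         = (sqrt (2 / pi) * sqrt (2 / pi)) * (\<mu> j * ?o j) / ?D"
        unfolding cheb_poly_cos[OF r] cheb_poly_cos[OF assms(5,6)] h_def[symmetric] if_not_P[OF False]
        by (simp only: times_divide_eq_left times_divide_eq_right divide_divide_eq_left mult_ac)
      then show ?thesis using False unfolding k2 by auto
    qed
  qed
  also have "\<dots> = ((2 / pi) * (\<Sum>j=0..n+m-1. \<mu> j * ?o j) - (if w = W1 then 1 / pi else 0)) / ?D"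
    by (simp add: sum_subtractf sum_distrib_left flip: sum_divide_distrib)
  also have "(\<Sum>j=0..n+m-1. \<mu> j * ?o j) = (?K (t - \<tau>) + osc_sign w * ?K (t + \<tau>)) / 2"
    unfolding o by (simp add: sum_distrib_left distrib_left sum.distrib add_divide_distrib sum_divide_distrib mult_ac)
  also have "(2 / pi) * ((?K (t - \<tau>) + osc_sign w * ?K (t + \<tau>)) / 2) - (if w = W1 then 1 / pi else 0)
     = (vp_kernel w n m (t - \<tau>) + osc_sign w * vp_kernel w n m (t + \<tau>)) / pi"
    unfolding vp_kernel_def \<mu>_def[symmetric] h_def[symmetric]
    by (cases w) (simp_all add: h_def half_shift_def osc_sign_def field_simps)
  finally have S: "(\<Sum>j=0..n+m-1. \<mu> j * cheb_poly w j (cos t) * cheb_poly w j (cos \<tau>))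
     = (vp_kernel w n m (t - \<tau>) + osc_sign w * vp_kernel w n m (t + \<tau>)) / pi / ?D" .
  have "vp_fundamental w n m k (cos t) = pi / freq w n * (root_density w \<tau>)\<^sup>2 *
     ((vp_kernel w n m (t - \<tau>) + osc_sign w * vp_kernel w n m (t + \<tau>)) / pi / ?D)"
    unfolding vp_fundamental_def christoffel_eq[OF assms(3,4)] cheb_zero_def \<tau>_def[symmetric] S[unfolded \<mu>_def] ..
  also have "\<dots> = root_density w \<tau> / root_density w t *
     ((vp_kernel w n m (t - \<tau>) + osc_sign w * vp_kernel w n m (t + \<tau>)) / freq w n)"
    using E f by (simp add: power2_eq_square)
  finally show ?thesis using E f unfolding vp_profile_def \<tau>_def
    by (simp add: abs_mult)
qed

section \<open>Size of the fundamental polynomials\<close>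

text \<open>At a node exactly one of \<open>sin (\<nu> \<tau>)\<close>, \<open>cos (\<nu> \<tau>)\<close> is zero and the other one is \<open>\<plusminus>1\<close>, so both shifts leave
the factor \<open>osc w (\<nu> t)\<close> behind, up to sign.\<close>

lemma sin_freq_shift:
  assumes "n > 0"
  shows "\<bar>sin (freq w n * (t - cheb_angle w n k))\<bar> = \<bar>osc w (freq w n * t)\<bar>"
    and "osc_sign w * sin (freq w n * (t + cheb_angle w n k)) = - sin (freq w n * (t - cheb_angle w n k))"
  using freq_angle[OF assms, of w k]
  by (auto simp: distrib_left right_diff_distrib sin_add sin_diff osc_def osc_sign_def abs_mult)

lemma abs_osc_sign [simp]: "\<bar>osc_sign w\<bar> = 1"
  by (simp add: osc_sign_def)

lemma sin_half_sum_diff: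
  "(sin ((t + s) / 2))\<^sup>2 - (sin ((t - s) / 2))\<^sup>2 = sin t * sin (s::real)"
proof -
  have "cos (t + s) = 1 - 2 * (sin ((t + s) / 2))\<^sup>2" "cos (t - s) = 1 - 2 * (sin ((t - s) / 2))\<^sup>2"
    by (rule cos_half2)+
  then show ?thesis unfolding cos_add cos_diff by simp
qed

lemma vp_profile_nonneg: "n > 0 \<Longrightarrow> vp_profile w n m k t \<ge> 0"
  using freq_bounds(1)[of n w] by (simp add: vp_profile_def)

lemma vp_profile_le_4:
  assumes "0 < m" "m < n"
  shows "vp_profile w n m k t \<le> 4"
proof -
  have f: "freq w n > 0" using assms freq_bounds(1)[of n w] by linarith
  have "\<bar>vp_kernel w n m (t - cheb_angle w n k) + osc_sign w * vp_kernel w n m (t + cheb_angle w n k)\<bar>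
     \<le> 2 * freq w n + 2 * freq w n"
    by (intro order.trans[OF abs_triangle_ineq] add_mono) (simp_all add: abs_mult vp_kernel_bound[OF assms])
  then show ?thesis using f by (simp add: vp_profile_def field_simps)
qed

text \<open>Both kernels carry the factor \<open>osc w (\<nu> t)\<close>, and the singularity of \<open>K(t + \<tau>)\<close> is the weaker one because
\<open>sin\<^sup>2 ((t + \<tau>)/2) - sin\<^sup>2 ((t - \<tau>)/2) = sin t sin \<tau>\<close>. The multiplied-out form holds also at \<open>t = \<tau>\<close>.\<close>

lemma vp_profile_decay:
  assumes "0 < m" "m < n" "1 \<le> k" "k \<le> n" "0 < t" "t < pi"
  shows "vp_profile w n m k t * (2 * freq w n * real m * (sin ((t - cheb_angle w n k) / 2))\<^sup>2)
     \<le> \<bar>osc w (freq w n * t)\<bar>"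
proof -
  define \<tau> where "\<tau> = cheb_angle w n k"
  define U where "U = \<bar>osc w (freq w n * t)\<bar>"
  note r = cheb_angle_range[OF assms(3,4), of w, folded \<tau>_def]
  have n: "n > 0" using assms by simp
  have f: "freq w n > 0" using assms freq_bounds(1)[of n w] by linarith
  let ?d = "(sin ((t - \<tau>) / 2))\<^sup>2" and ?s = "(sin ((t + \<tau>) / 2))\<^sup>2"
  let ?K = "vp_kernel w n m"
  have ds: "?d \<le> ?s" using sin_half_sum_diff[of t \<tau>] r assms(5,6)
      mult_pos_pos[OF sin_gt_zero sin_gt_zero, of t \<tau>] by linarith
  have "\<bar>?K (t - \<tau>)\<bar> * (4 * real m * ?d) = \<bar>?K (t - \<tau>) * (4 * real m * ?d)\<bar>"
    by (simp add: abs_mult)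
  also have "\<dots> \<le> U * 1"
    unfolding vp_kernel_closed[OF assms(1,2)] abs_mult U_def \<tau>_def sin_freq_shift(1)[OF n]
    by (intro mult_mono) auto
  finally have 1: "\<bar>?K (t - \<tau>)\<bar> * (4 * real m * ?d) \<le> U" by simp
  have e: "\<bar>sin (freq w n * (t + \<tau>))\<bar> = U"
    using arg_cong[OF sin_freq_shift(2)[OF n, of w t k], of abs] sin_freq_shift(1)[OF n, of w t k]
    by (simp add: abs_mult U_def \<tau>_def)
  have "\<bar>?K (t + \<tau>)\<bar> * (4 * real m * ?d) \<le> \<bar>?K (t + \<tau>)\<bar> * (4 * real m * ?s)"
    using ds by (intro mult_left_mono) auto
  also have "\<dots> = \<bar>?K (t + \<tau>) * (4 * real m * ?s)\<bar>" by (simp add: abs_mult)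
  also have "\<dots> \<le> U * 1"
    unfolding vp_kernel_closed[OF assms(1,2)] abs_mult e
    by (intro mult_mono) (auto simp: U_def)
  finally have 2: "\<bar>?K (t + \<tau>)\<bar> * (4 * real m * ?d) \<le> U" by simp
  have "\<bar>?K (t - \<tau>) + osc_sign w * ?K (t + \<tau>)\<bar> * (4 * real m * ?d)
     \<le> (\<bar>?K (t - \<tau>)\<bar> + \<bar>?K (t + \<tau>)\<bar>) * (4 * real m * ?d)"
    using abs_triangle_ineq[of "?K (t - \<tau>)" "osc_sign w * ?K (t + \<tau>)"]
    by (intro mult_right_mono) (auto simp: abs_mult)
  also have "\<dots> \<le> 2 * U" using 1 2 by (simp add: distrib_right)
  finally show ?thesis using f by (simp add: vp_profile_def U_def \<tau>_def mult_ac)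
qed

text \<open>If \<open>sin (m t) = 0\<close> then \<open>sin (m (t - \<tau>))\<close> and \<open>sin (m (t + \<tau>))\<close> are opposite, as are the frequency factors
by \<open>sin_freq_shift\<close>. So the numerators \<open>P\<close> of the two kernels coincide and the contributions add up.\<close>

lemma vp_profile_lower:
  assumes "0 < m" "m < n" "1 \<le> k" "k \<le> n" "0 < t" "t < pi" and z: "sin (real m * t) = 0"
  shows "\<bar>osc w (freq w n * t)\<bar> * \<bar>sin (real m * cheb_angle w n k)\<bar>
     \<le> vp_profile w n m k t * (4 * freq w n * real m * (sin ((t + cheb_angle w n k) / 2))\<^sup>2)"
proof -
  define \<tau> where "\<tau> = cheb_angle w n k"
  note r = cheb_angle_range[OF assms(3,4), of w, folded \<tau>_def]
  have n: "n > 0" using assms by simp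
  have f: "freq w n > 0" using assms freq_bounds(1)[of n w] by linarith
  let ?d = "(sin ((t - \<tau>) / 2))\<^sup>2" and ?s = "(sin ((t + \<tau>) / 2))\<^sup>2"
  let ?K = "vp_kernel w n m"
  define P where "P = sin (freq w n * (t - \<tau>)) * sin (real m * (t - \<tau>))"
  have c1: "\<bar>cos (real m * t)\<bar> = 1"
    using z sin_cos_squared_add[of "real m * t"] by (simp add: power2_eq_1_iff abs_if) auto
  have absP: "\<bar>P\<bar> = \<bar>osc w (freq w n * t)\<bar> * \<bar>sin (real m * \<tau>)\<bar>"
    unfolding P_def abs_mult \<tau>_def sin_freq_shift(1)[OF n] using z c1
    by (simp add: right_diff_distrib sin_diff abs_mult)
  have K1: "?K (t - \<tau>) * (4 * real m * ?d) = P"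
    unfolding P_def by (rule vp_kernel_closed[OF assms(1,2)])
  have "osc_sign w * (?K (t + \<tau>) * (4 * real m * ?s)) =
      (osc_sign w * sin (freq w n * (t + \<tau>))) * sin (real m * (t + \<tau>))"
    unfolding vp_kernel_closed[OF assms(1,2)] by simp
  also have "\<dots> = P"
    unfolding \<tau>_def sin_freq_shift(2)[OF n] P_def using z
    by (simp add: right_diff_distrib[of "real m"] distrib_left[of "real m"] sin_diff[of "real m * t"] sin_add[of "real m * t"])
  finally have K2: "osc_sign w * (?K (t + \<tau>) * (4 * real m * ?s)) = P" .
  have "sin ((t + \<tau>) / 2) > 0" using r assms(5,6) by (intro sin_gt_zero) auto
  then have spos: "?s > 0" by simp
  have "\<bar>P\<bar> \<le> \<bar>?K (t - \<tau>) + osc_sign w * ?K (t + \<tau>)\<bar> * (4 * real m * ?s)"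
  proof (cases "?d = 0")
    case True then have "P = 0" using K1 by simp
    then show ?thesis by simp
  next
    case False
    then have dpos: "?d > 0" by simp
    then have q: "?s / ?d > 0" using spos by (rule divide_pos_pos[rotated])
    have "(?K (t - \<tau>) + osc_sign w * ?K (t + \<tau>)) * (4 * real m * ?s)
       = ?K (t - \<tau>) * (4 * real m * ?d) * (?s / ?d) + osc_sign w * (?K (t + \<tau>) * (4 * real m * ?s))"
      using dpos by (simp add: field_simps)
    also have "\<dots> = P * (?s / ?d + 1)" unfolding K1 K2 by (simp add: distrib_left)
    finally have "\<bar>(?K (t - \<tau>) + osc_sign w * ?K (t + \<tau>)) * (4 * real m * ?s)\<bar> = \<bar>P * (?s / ?d + 1)\<bar>"
      by (rule arg_cong)
    also have "\<dots> = \<bar>P\<bar> * (?s / ?d + 1)" using q unfolding abs_mult by (simp only: abs_of_pos add_pos_pos zero_less_one)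
    also have "\<dots> \<ge> \<bar>P\<bar> * 1" using q by (intro mult_left_mono) auto
    finally show ?thesis by (simp add: abs_mult)
  qed
  then show ?thesis using f unfolding absP[symmetric] \<tau>_def[symmetric] vp_profile_def by simp
qed

section \<open>The weighted Lebesgue function\<close>

definition weight_ratio :: "real \<Rightarrow> real \<Rightarrow> real \<Rightarrow> real \<Rightarrow> real" where
  "weight_ratio \<alpha> \<beta> t s = (sin (t/2) / sin (s/2)) powr \<alpha> * (cos (t/2) / cos (s/2)) powr \<beta>"

definition vp_lebesgue :: "chebyshev \<Rightarrow> real \<Rightarrow> real \<Rightarrow> nat \<Rightarrow> nat \<Rightarrow> real \<Rightarrow> real" where
  "vp_lebesgue w \<alpha> \<beta> n m t =
     (\<Sum>k=1..n. weight_ratio \<alpha> \<beta> t (cheb_angle w n k) * vp_profile w n m k t)"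

lemma half_angle_pos:
  assumes "0 < t" "t < pi"
  shows "sin (t/2) > 0" "cos (t/2) > 0"
  using assms by (auto intro!: sin_gt_zero cos_gt_zero)

lemma jacobi_weight_cos:
  assumes "0 < t" "t < pi"
  shows "jacobi_weight \<gamma> \<delta> (cos t) = (2 * (sin (t/2))\<^sup>2) powr \<gamma> * (2 * (cos (t/2))\<^sup>2) powr \<delta>"
proof -
  have "1 - cos t = 2 * (sin (t/2))\<^sup>2" "1 + cos t = 2 * (cos (t/2))\<^sup>2"
    using cos_half1[of t] cos_half2[of t] by auto
  then show ?thesis using half_angle_pos[OF assms] by (simp add: jacobi_weight_def)
qed

lemma jacobi_weight_cos_pos:
  assumes "0 < t" "t < pi"
  shows "jacobi_weight \<gamma> \<delta> (cos t) > 0"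
  using half_angle_pos[OF assms] by (simp add: jacobi_weight_cos[OF assms])

lemma powr_ratio:
  fixes a b :: real
  assumes "a > 0" "b > 0"
  shows "(2 * a\<^sup>2) powr \<gamma> / (2 * b\<^sup>2) powr \<gamma> = (a / b) powr (2 * \<gamma>)"
proof -
  have "(2 * a\<^sup>2) powr \<gamma> / (2 * b\<^sup>2) powr \<gamma> = ((a / b)\<^sup>2) powr \<gamma>"
    using assms by (simp add: powr_divide[symmetric] power_divide)
  also have "(a / b)\<^sup>2 = (a / b) powr 2" using assms by (simp add: powr_numeral)
  finally show ?thesis by (simp add: powr_powr)
qed

text \<open>The Jacobi weight contributes the exponents \<open>2 \<gamma>\<close>, \<open>2 \<delta>\<close> of the half-angle quotients and the root density
lowers them by \<open>0\<close> or \<open>1\<close>.\<close>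

lemma weight_ratio_eq:
  assumes "0 < t" "t < pi" "0 < s" "s < pi"
  shows "jacobi_weight \<gamma> \<delta> (cos t) / jacobi_weight \<gamma> \<delta> (cos s) * (root_density w s / root_density w t)
    = weight_ratio (2 * \<gamma> - real (sin_exp w)) (2 * \<delta> - real (cos_exp w)) t s"
proof -
  note p = half_angle_pos[OF assms(1,2)] half_angle_pos[OF assms(3,4)]
  have "root_density w s / root_density w t
     = (sin (t/2) / sin (s/2)) powr (- real (sin_exp w)) * (cos (t/2) / cos (s/2)) powr (- real (cos_exp w))"
    using p by (simp add: root_density_def powr_minus powr_realpow power_mult_distrib power_divide)
  moreover have "jacobi_weight \<gamma> \<delta> (cos t) / jacobi_weight \<gamma> \<delta> (cos s)
     = (sin (t/2) / sin (s/2)) powr (2 * \<gamma>) * (cos (t/2) / cos (s/2)) powr (2 * \<delta>)"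
    using p by (simp add: jacobi_weight_cos assms flip: powr_ratio)
  ultimately show ?thesis
    unfolding weight_ratio_def diff_conv_add_uminus powr_add by (simp only: mult_ac)
qed

lemma vp_lebesgue_eq:
  assumes "0 < m" "m < n" "0 < t" "t < pi"
  shows "jacobi_weight \<gamma> \<delta> (cos t) *
      (\<Sum>k=1..n. \<bar>vp_fundamental w n m k (cos t)\<bar> / jacobi_weight \<gamma> \<delta> (cheb_zero w n k))
    = vp_lebesgue w (2 * \<gamma> - real (sin_exp w)) (2 * \<delta> - real (cos_exp w)) n m t"
  unfolding vp_lebesgue_def sum_distrib_left
proof (intro sum.cong refl)
  fix k assume "k \<in> {1..n}"
  then have k: "1 \<le> k" "k \<le> n" by auto
  note r = cheb_angle_range[OF k, of w]
  show "jacobi_weight \<gamma> \<delta> (cos t) * (\<bar>vp_fundamental w n m k (cos t)\<bar> / jacobi_weight \<gamma> \<delta> (cheb_zero w n k))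
    = weight_ratio (2 * \<gamma> - real (sin_exp w)) (2 * \<delta> - real (cos_exp w)) t (cheb_angle w n k) * vp_profile w n m k t"
    unfolding vp_fundamental_cos[OF assms(1,2) k assms(3,4)] cheb_zero_def
      weight_ratio_eq[OF assms(3,4) r, symmetric] by (simp add: mult_ac)
qed

lemma continuous_on_jacobi_weight:
  assumes "\<gamma> \<ge> 0" "\<delta> \<ge> 0"
  shows "continuous_on {-1..1} (jacobi_weight \<gamma> \<delta>)"
proof -
  have a: "continuous_on {-1..1} (\<lambda>x::real. (1 - x) powr c)" if "c > 0" for c
    by (rule continuous_on_powr') (use that in \<open>auto intro!: continuous_intros\<close>)
  have b: "continuous_on {-1..1} (\<lambda>x::real. (1 + x) powr c)" if "c > 0" for c
    by (rule continuous_on_powr') (use that in \<open>auto intro!: continuous_intros\<close>)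
  have "continuous_on {-1..1} (\<lambda>x::real. if \<gamma> = 0 then 1 else (1 - x) powr \<gamma>)"
    "continuous_on {-1..1} (\<lambda>x::real. if \<delta> = 0 then 1 else (1 + x) powr \<delta>)"
    using a[of \<gamma>] b[of \<delta>] assms by (cases "\<gamma> = 0"; cases "\<delta> = 0"; simp)+
  then show ?thesis
    unfolding jacobi_weight_def[abs_def] by (rule continuous_on_mult)
qed

lemma jacobi_weight_nonneg: "jacobi_weight \<gamma> \<delta> x \<ge> 0"
  by (simp add: jacobi_weight_def)

text \<open>The norm is controlled by \<open>u(x) \<Sum>\<^sub>k \<bar>\<Phi>\<^sub>k(x)\<bar> / u(x\<^sub>k)\<close>. This function is continuous on \<open>[-1, 1]\<close>, so a bound on the
open interval, where the angle variable is available, extends to the endpoints.\<close>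

lemma lebesgue_const_le:
  assumes "0 < m" "m < n" "\<gamma> \<ge> 0" "\<delta> \<ge> 0"
    and M: "\<And>t. 0 < t \<Longrightarrow> t < pi \<Longrightarrow>
      vp_lebesgue w (2 * \<gamma> - real (sin_exp w)) (2 * \<delta> - real (cos_exp w)) n m t \<le> M"
  shows "lebesgue_const w (jacobi_weight \<gamma> \<delta>) n m \<le> ereal M"
proof -
  define u where "u = jacobi_weight \<gamma> \<delta>"
  define L where "L x = u x * (\<Sum>k=1..n. \<bar>vp_fundamental w n m k x\<bar> / u (cheb_zero w n k))" for x
  have u0: "u x \<ge> 0" for x by (simp add: u_def jacobi_weight_nonneg)
  have unode: "u (cheb_zero w n k) > 0" "cheb_zero w n k \<in> {-1..1}" if "k \<in> {1..n}" for k
    using jacobi_weight_cos_pos cheb_angle_range[of k n w] that by (auto simp: u_def cheb_zero_def)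
  have cont: "continuous_on {-1..1} L"
    unfolding L_def vp_fundamental_def
    using unode(1) continuous_on_jacobi_weight[OF assms(3,4)]
    by (auto intro!: continuous_intros simp: u_def less_imp_neq[symmetric])
  have L: "L x \<le> M" if "x \<in> {-1..1}" for x
  proof (rule continuous_le_on_closure[of "{-1<..<1}" L])
    have cl: "closure {-1<..<1::real} = {-1..1}" by (rule closure_greaterThanLessThan) simp
    show "continuous_on (closure {-1<..<1}) L" "x \<in> closure {-1<..<1}" unfolding cl by (rule cont, rule that)
    fix y :: real assume "y \<in> {-1<..<1}"
    then have "y \<in> cos ` {0<..<pi}" by (simp only: image_cos_open)
    then obtain t where "0 < t" "t < pi" "y = cos t" by auto
    then show "L y \<le> M"
      using vp_lebesgue_eq[OF assms(1,2), of t \<gamma> \<delta> w] M[of t] unfolding L_def u_def by metis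
  qed
  have "sup_norm (\<lambda>x. vp_operator w n m f x * u x) / sup_norm (\<lambda>x. f x * u x) \<le> ereal M"
    if pos: "0 < sup_norm (\<lambda>x. f x * u x)" and fin: "sup_norm (\<lambda>x. f x * u x) < \<infinity>" for f
  proof -
    obtain c where c: "sup_norm (\<lambda>x. f x * u x) = ereal c" "c > 0"
      using pos fin by (cases "sup_norm (\<lambda>x. f x * u x)") auto
    have fb: "\<bar>f x\<bar> * u x \<le> c" if "x \<in> {-1..1}" for x
    proof -
      have "ereal \<bar>f x * u x\<bar> \<le> sup_norm (\<lambda>x. f x * u x)"
        unfolding sup_norm_def using that by (rule SUP_upper)
      then show ?thesis using u0[of x] by (simp add: c abs_mult)
    qed
    have "\<bar>vp_operator w n m f x * u x\<bar> \<le> M * c" if x: "x \<in> {-1..1}" for x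
    proof -
      have "\<bar>vp_operator w n m f x * u x\<bar> = \<bar>vp_operator w n m f x\<bar> * u x"
        using u0[of x] by (simp add: abs_mult)
      also have "\<dots> \<le> (\<Sum>k=1..n. c / u (cheb_zero w n k) * \<bar>vp_fundamental w n m k x\<bar>) * u x"
      proof (intro mult_right_mono u0)
        have "\<bar>vp_operator w n m f x\<bar> \<le> (\<Sum>k=1..n. \<bar>f (cheb_zero w n k)\<bar> * \<bar>vp_fundamental w n m k x\<bar>)"
          unfolding vp_operator_def by (rule order.trans[OF sum_abs]) (simp add: abs_mult)
        also have "\<dots> \<le> (\<Sum>k=1..n. c / u (cheb_zero w n k) * \<bar>vp_fundamental w n m k x\<bar>)"
          using fb[OF unode(2)] unode(1)
          by (intro sum_mono mult_right_mono) (auto simp: pos_le_divide_eq)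
        finally show "\<bar>vp_operator w n m f x\<bar> \<le> (\<Sum>k=1..n. c / u (cheb_zero w n k) * \<bar>vp_fundamental w n m k x\<bar>)" .
      qed
      also have "\<dots> = L x * c"
        by (simp add: L_def sum_distrib_left sum_distrib_right mult_ac)
      also have "\<dots> \<le> M * c" using L[OF x] c(2) by (intro mult_right_mono) auto
      finally show ?thesis .
    qed
    then have "sup_norm (\<lambda>x. vp_operator w n m f x * u x) \<le> ereal (M * c)"
      unfolding sup_norm_def by (intro SUP_least) auto
    then have "sup_norm (\<lambda>x. vp_operator w n m f x * u x) / ereal c \<le> ereal (M * c) / ereal c"
      using c(2) by (intro ereal_divide_right_mono) auto
    then show ?thesis using c by simp
  qed
  then show ?thesis unfolding lebesgue_const_def u_def[symmetric] by (intro SUP_least) auto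
qed

lemma cheb_zero_inj: "inj_on (cheb_zero w n) {1..n}"
proof (rule inj_onI)
  fix j k assume jk: "j \<in> {1..n}" "k \<in> {1..n}" and e: "cheb_zero w n j = cheb_zero w n k"
  have f: "freq w n > 0" using jk freq_bounds(1)[of n w] by auto
  have "cheb_angle w n j = cheb_angle w n k"
    using jk cheb_angle_range[of j n w] cheb_angle_range[of k n w]
    by (intro cos_inj_pi[OF _ _ _ _ e[unfolded cheb_zero_def]]) auto
  then have "2 * real j - 1 + real (sin_exp w) = 2 * real k - 1 + real (sin_exp w)"
    using f unfolding cheb_angle_eq by simp
  then show "j = k" by simp
qed

text \<open>The extremal function takes the value \<open>\<plusminus>1 / u\<close> at the nodes, with the sign of \<open>\<Phi>\<^sub>k (cos t)\<close>, and \<open>0\<close> elsewhere.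
It is admissible because it vanishes near the endpoints.\<close>

lemma lebesgue_const_ge:
  assumes "0 < m" "m < n" "0 < t" "t < pi"
  shows "ereal (vp_lebesgue w (2 * \<gamma> - real (sin_exp w)) (2 * \<delta> - real (cos_exp w)) n m t)
    \<le> lebesgue_const w (jacobi_weight \<gamma> \<delta>) n m"
proof -
  define u where "u = jacobi_weight \<gamma> \<delta>"
  define N where "N = cheb_zero w n ` {1..n}"
  define \<sigma> where "\<sigma> y = (if vp_fundamental w n m (inv_into {1..n} (cheb_zero w n) y) (cos t) \<ge> 0 then 1 else -1::real)" for y
  define f where "f y = (if y \<in> N then \<sigma> y / u y else 0)" for y
  have unode: "u (cheb_zero w n k) > 0" "cheb_zero w n k \<in> {-1<..<1}" if "k \<in> {1..n}" for k
    using jacobi_weight_cos_pos cheb_angle_range[of k n w] that image_cos_open by (auto simp: u_def cheb_zero_def)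
  have u0: "u x \<ge> 0" for x by (simp add: u_def jacobi_weight_nonneg)
  have fN: "\<bar>f y * u y\<bar> = (if y \<in> N then 1 else 0)" for y
  proof (cases "y \<in> N")
    case True
    then have "u y > 0" using unode(1) by (auto simp: N_def)
    then show ?thesis using True by (simp add: f_def \<sigma>_def)
  qed (simp add: f_def)
  have N1: "cheb_zero w n 1 \<in> N" "cheb_zero w n 1 \<in> {-1..1}"
    using assms unode(2)[of 1] by (auto simp: N_def)
  have norm: "sup_norm (\<lambda>x. f x * u x) = 1"
  proof (rule antisym)
    show "sup_norm (\<lambda>x. f x * u x) \<le> 1" unfolding sup_norm_def fN by (intro SUP_least) auto
    have "ereal \<bar>f (cheb_zero w n 1) * u (cheb_zero w n 1)\<bar> \<le> sup_norm (\<lambda>x. f x * u x)"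
      unfolding sup_norm_def using N1(2) by (rule SUP_upper)
    then show "1 \<le> sup_norm (\<lambda>x. f x * u x)" unfolding fN using N1 by (simp add: one_ereal_def)
  qed
  have tend: "((\<lambda>x. f x * u x) \<longlongrightarrow> 0) (at a within S)" if "a \<notin> {-1<..<1}" for a S
  proof (rule tendsto_eventually)
    have "open (- N)" using finite_imp_closed[of N] by (simp add: N_def open_Compl)
    moreover have "a \<in> - N" using that unode(2) by (auto simp: N_def)
    ultimately have "eventually (\<lambda>x. x \<in> - N) (at a within S)"
      by (metis (no_types, lifting) eventually_at_topological)
    then show "eventually (\<lambda>x. f x * u x = 0) (at a within S)"
      by eventually_elim (simp add: f_def)
  qed
  have adm: "admissible u f" unfolding admissible_def by (auto intro!: tend)
  have "vp_operator w n m f (cos t) = (\<Sum>k=1..n. \<bar>vp_fundamental w n m k (cos t)\<bar> / u (cheb_zero w n k))"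
    unfolding vp_operator_def
  proof (intro sum.cong refl)
    fix k assume k: "k \<in> {1..n}"
    show "f (cheb_zero w n k) * vp_fundamental w n m k (cos t)
       = \<bar>vp_fundamental w n m k (cos t)\<bar> / u (cheb_zero w n k)"
      using k inv_into_f_f[OF cheb_zero_inj k] by (simp add: f_def N_def \<sigma>_def)
  qed
  then have "vp_operator w n m f (cos t) * u (cos t) =
     vp_lebesgue w (2 * \<gamma> - real (sin_exp w)) (2 * \<delta> - real (cos_exp w)) n m t"
    using vp_lebesgue_eq[OF assms, of \<gamma> \<delta> w] by (simp add: u_def mult.commute)
  then have "ereal (vp_lebesgue w (2 * \<gamma> - real (sin_exp w)) (2 * \<delta> - real (cos_exp w)) n m t)
     \<le> ereal \<bar>vp_operator w n m f (cos t) * u (cos t)\<bar>" by simp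
  also have "\<dots> \<le> sup_norm (\<lambda>x. vp_operator w n m f x * u x)"
    unfolding sup_norm_def by (rule SUP_upper) auto
  also have "\<dots> = sup_norm (\<lambda>x. vp_operator w n m f x * u x) / sup_norm (\<lambda>x. f x * u x)"
    unfolding norm by (simp add: one_ereal_def divide_ereal_def)
  also have "\<dots> \<le> lebesgue_const w u n m"
    unfolding lebesgue_const_def by (rule SUP_upper) (auto simp: adm norm)
  finally show ?thesis by (simp add: u_def)
qed

section \<open>Termwise bounds for the weighted Lebesgue function\<close>

text \<open>Here \<open>A\<close>, \<open>A1\<close> stand for \<open>sin (t/2)\<close>, \<open>sin (\<tau>/2)\<close> (or the cosines), \<open>R\<close> for the profile and \<open>S\<close> for the
absolute value of the common oscillating factor. Close to the node the quotient is bounded. Otherwise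
\<open>A \<le> 3 d\<close>, so for \<open>\<alpha> \<ge> 0\<close> the quotient costs at most \<open>(3 d / A1)\<^sup>2\<close>, while for \<open>\<alpha> < 0\<close> the inequality
\<open>S \<le> S\<^sup>-\<^sup>\<alpha> \<le> (4 N A)\<^sup>-\<^sup>\<alpha>\<close> trades \<open>A\<close> for \<open>A1\<close>.\<close>

lemma one_sided_bound:
  fixes A A1 d N R S C p \<alpha> :: real
  assumes pos: "A > 0" "A1 > 0" "d \<ge> 0" "N > 0" and X1: "1 \<le> 2 * N * A1"
    and tri: "A \<le> A1 + d" "A1 \<le> A + d"
    and R: "0 \<le> R" "R \<le> 4" "R * (N * d)\<^sup>2 \<le> C * S" and C: "C \<ge> 1"
    and S: "0 \<le> S" "S \<le> 1" "\<alpha> < 0 \<Longrightarrow> S \<le> 4 * N * A"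
    and \<alpha>: "-1 < \<alpha>" "\<alpha> \<le> 2" and p: "p \<le> 2" "p \<le> 2 + \<alpha>"
  shows "(A / A1) powr \<alpha> * R \<le> 40 * C * (1 / (1 + (N * d)\<^sup>2) + (2 * N * A1) powr (-p))"
proof (cases "d \<le> A1 / 2")
  case near: True
  have "(A / A1) powr \<alpha> \<le> 4"
  proof (cases "\<alpha> \<ge> 0")
    case True
    have "(A / A1) powr \<alpha> \<le> (2::real) powr \<alpha>"
      using pos tri near True by (intro powr_mono2) (auto simp: field_simps)
    also have "\<dots> \<le> 2 powr 2" using \<alpha> by (intro powr_mono) auto
    finally show ?thesis by simp
  next
    case False
    have "(A / A1) powr \<alpha> \<le> (1/2::real) powr \<alpha>"
      using pos tri near False by (intro powr_mono2') (auto simp: field_simps)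
    also have "\<dots> = 2 powr (-\<alpha>)" by (simp add: powr_minus_divide powr_divide)
    also have "\<dots> \<le> 2 powr 1" using \<alpha> by (intro powr_mono) auto
    finally show ?thesis by simp
  qed
  moreover have "R \<le> 5 * C * (1 / (1 + (N * d)\<^sup>2))"
  proof -
    have "C * S \<le> C" using S C mult_left_mono[of S 1 C] by simp
    then have "R * (1 + (N * d)\<^sup>2) \<le> 5 * C" using R C unfolding distrib_left by linarith
    then show ?thesis by (simp add: pos_le_divide_eq add_pos_nonneg)
  qed
  ultimately have "(A / A1) powr \<alpha> * R \<le> 4 * (5 * C * (1 / (1 + (N * d)\<^sup>2)))"
    using R C by (intro mult_mono) auto
  also have "\<dots> \<le> 40 * C * (1 / (1 + (N * d)\<^sup>2) + (2 * N * A1) powr (-p))"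
  proof -
    define q where "q = 1 / (1 + (N * d)\<^sup>2)"
    have "0 \<le> C * q" "0 \<le> C * (2 * N * A1) powr (-p)"
      using C by (auto simp: q_def add_nonneg_nonneg)
    then show ?thesis unfolding q_def[symmetric] distrib_left by linarith
  qed
  finally show ?thesis .
next
  case False
  then have far: "d > A1 / 2" by simp
  then have d: "d > 0" using pos by linarith
  let ?X = "2 * N * A1"
  have Nd: "(N * d)\<^sup>2 \<ge> ?X\<^sup>2 / 16"
  proof -
    have "?X / 4 \<le> N * d" using far pos by simp
    then have "(?X / 4)\<^sup>2 \<le> (N * d)\<^sup>2" using pos by (intro power_mono) auto
    moreover have "(?X / 4)\<^sup>2 = ?X\<^sup>2 / 16" unfolding power_divide by simp
    ultimately show ?thesis by (simp only:)
  qed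
  have Ndpos: "(N * d)\<^sup>2 > 0" using d pos by simp
  have "?X powr 2 = ?X\<^sup>2" by (rule powr_numeral) (use X1 in linarith)
  then have X2: "?X powr (-2) = 1 / ?X\<^sup>2"
    by (simp only: powr_minus_divide)
  have main: "(A / A1) powr \<alpha> * R \<le> 40 * C * ?X powr (-p)"
  proof (cases "\<alpha> \<ge> 0")
    case True
    have "(A / A1) powr \<alpha> \<le> (3 * d / A1) powr \<alpha>"
      using pos tri far True by (intro powr_mono2) (auto simp: field_simps)
    also have "\<dots> \<le> (3 * d / A1) powr 2" using pos far \<alpha> by (intro powr_mono) (auto simp: field_simps)
    also have "\<dots> = 9 * d\<^sup>2 / A1\<^sup>2" using d pos by (simp add: powr_numeral power_divide power_mult_distrib)
    finally have "(A / A1) powr \<alpha> * R \<le> 9 * d\<^sup>2 / A1\<^sup>2 * (C / (N * d)\<^sup>2)"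
    proof (rule mult_mono)
      have "C * S \<le> C" using S C mult_left_mono[of S 1 C] by simp
      then have "R * (N * d)\<^sup>2 \<le> C" using R(3) by linarith
      then show "R \<le> C / (N * d)\<^sup>2" using Ndpos by (simp add: pos_le_divide_eq)
    qed (use R in auto)
    also have "\<dots> = 36 * C * ?X powr (-2)"
      unfolding X2 using d pos by (simp add: power_mult_distrib)
    also have "\<dots> \<le> 40 * C * ?X powr (-p)"
      using C X1 p by (intro mult_mono powr_mono) auto
    finally show ?thesis .
  next
    case False
    have "S \<le> S powr (-\<alpha>)"
    proof (cases "S = 0")
      case False
      have "S powr 1 \<le> S powr (-\<alpha>)" using S False \<alpha> by (intro powr_mono') auto
      then show ?thesis using S False by simp
    qed simp
    also have "\<dots> \<le> (4 * N * A) powr (-\<alpha>)" using S False by (intro powr_mono2) auto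
    finally have "(A / A1) powr \<alpha> * S \<le> (A / A1) powr \<alpha> * (4 * N * A) powr (-\<alpha>)"
      by (intro mult_left_mono) auto
    also have "\<dots> = (4 * N * A1) powr (-\<alpha>)"
      using pos by (simp add: powr_mult powr_divide powr_minus field_simps)
    also have "\<dots> = 2 powr (-\<alpha>) * ?X powr (-\<alpha>)"
      using pos powr_mult[of 2 ?X "-\<alpha>"] by (simp add: mult.assoc)
    also have "\<dots> \<le> 2 powr 1 * ?X powr (-\<alpha>)"
      using \<alpha> by (intro mult_right_mono powr_mono) auto
    finally have 1: "(A / A1) powr \<alpha> * S \<le> 2 * ?X powr (-\<alpha>)" by simp
    have "(A / A1) powr \<alpha> * R \<le> (A / A1) powr \<alpha> * (C * S / (N * d)\<^sup>2)"
      using R(3) Ndpos by (intro mult_left_mono) (auto simp: pos_le_divide_eq)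
    also have "\<dots> = C / (N * d)\<^sup>2 * ((A / A1) powr \<alpha> * S)" by simp
    also have "\<dots> \<le> C / (?X\<^sup>2 / 16) * (2 * ?X powr (-\<alpha>))"
    proof (rule mult_mono[OF _ 1])
      have "?X\<^sup>2 / 16 > 0" using pos by simp
      then show "C / (N * d)\<^sup>2 \<le> C / (?X\<^sup>2 / 16)"
        using C Nd Ndpos by (intro divide_left_mono mult_pos_pos) linarith+
    qed (use C S in auto)
    also have "\<dots> = 32 * C * (?X powr (-2) * ?X powr (-\<alpha>))" unfolding X2 by simp
    also have "?X powr (-2) * ?X powr (-\<alpha>) = ?X powr (-2-\<alpha>)" by (simp add: powr_add[symmetric])
    also have "32 * C * ?X powr (-2-\<alpha>) \<le> 40 * C * ?X powr (-p)"
      using C X1 p by (intro mult_mono powr_mono) auto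
    finally show ?thesis .
  qed
  also have "\<dots> \<le> 40 * C * (1 / (1 + (N * d)\<^sup>2) + ?X powr (-p))"
    using C by (simp add: add_nonneg_nonneg)
  finally show ?thesis .
qed

text \<open>If the node is close with respect to one of the endpoints, that quotient is bounded and
\<open>one_sided_bound\<close> handles the other. If it is far with respect to both, \<open>d\<close> is bounded below; then the
quotient with exponent \<open>\<alpha> \<le> 2 + \<beta>\<close> is at most \<open>A1\<close> to the power \<open>-(2 + \<beta>)\<close>, the other quotient times \<open>S\<close> is
at most \<open>2 (2 N)\<^sup>-\<^sup>\<beta>\<close>, and \<open>R \<le> 8 C S / N\<^sup>2\<close>: together a power \<open>-(2 + \<beta>)\<close> of \<open>N A1\<close>.\<close>

lemma mixed_sign_bound:
  fixes A A1 B B1 d N R S C p \<alpha> \<beta> :: real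
  assumes pos: "A > 0" "A1 > 0" "B > 0" "B1 > 0" "d \<ge> 0" "N > 0"
    and X1: "1 \<le> 2 * N * A1" and Y1: "1 \<le> 2 * N * B1"
    and circ: "A\<^sup>2 + B\<^sup>2 = 1" "A1\<^sup>2 + B1\<^sup>2 = 1"
    and tri: "A \<le> A1 + d" "A1 \<le> A + d" "B \<le> B1 + d" "B1 \<le> B + d"
    and R: "0 \<le> R" "R \<le> 4" "R * (N * d)\<^sup>2 \<le> C * S" and C: "C \<ge> 1"
    and S: "0 \<le> S" "S \<le> 1" "\<beta> < 0 \<Longrightarrow> S \<le> 4 * N * B"
    and \<alpha>: "0 \<le> \<alpha>" "\<alpha> \<le> 2" and \<beta>: "-1 < \<beta>" "\<beta> < 0" and ab: "\<alpha> - \<beta> \<le> 2"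
    and p: "p \<le> 2 + \<beta>"
  shows "(A / A1) powr \<alpha> * (B / B1) powr \<beta> * R
    \<le> 400 * C * (1 / (1 + (N * d)\<^sup>2) + (2 * N * A1) powr (-p) + (2 * N * B1) powr (-p))"
proof -
  let ?q = "1 / (1 + (N * d)\<^sup>2)" and ?X = "(2 * N * A1) powr (-p)" and ?Y = "(2 * N * B1) powr (-p)"
  have LA: "(A / A1) powr \<alpha> * R \<le> 40 * C * (?q + ?X)"
    using assms by (intro one_sided_bound) auto
  have LB: "(B / B1) powr \<beta> * R \<le> 40 * C * (?q + ?Y)"
    using assms by (intro one_sided_bound) auto
  have nn: "?q \<ge> 0" "?X \<ge> 0" "?Y \<ge> 0" by (auto simp: add_nonneg_nonneg)
  have fin: "z \<le> 400 * C * (?q + ?X + ?Y)"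
    if "z \<le> 10 * (40 * C * (?q + ?X)) \<or> z \<le> 10 * (40 * C * (?q + ?Y))" for z
  proof -
    have "C * ?q \<ge> 0" "C * ?X \<ge> 0" "C * ?Y \<ge> 0" using nn C by auto
    then show ?thesis using that by (auto simp only: distrib_left mult.assoc) 
  qed
  consider "d \<le> A1 / 2" | "d \<le> B1 / 2" | "d > A1 / 2" "d > B1 / 2" by linarith
  then show ?thesis
  proof cases
    case 1
    have "(A / A1) powr \<alpha> \<le> 2 powr \<alpha>"
      using pos tri 1 \<alpha> by (intro powr_mono2) (auto simp: field_simps)
    also have "\<dots> \<le> 2 powr 2" using \<alpha> by (intro powr_mono) auto
    finally have "(A / A1) powr \<alpha> * ((B / B1) powr \<beta> * R) \<le> 10 * (40 * C * (?q + ?Y))"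
      using R by (intro mult_mono[OF _ LB]) auto
    then show ?thesis by (intro fin) (simp add: mult.assoc)
  next
    case 2
    have "(B / B1) powr \<beta> \<le> (1/2) powr \<beta>"
      using pos tri 2 \<beta> by (intro powr_mono2') (auto simp: field_simps)
    also have "\<dots> = 2 powr (-\<beta>)" by (simp add: powr_minus_divide powr_divide)
    also have "\<dots> \<le> 2 powr 1" using \<beta> by (intro powr_mono) auto
    finally have "(B / B1) powr \<beta> * ((A / A1) powr \<alpha> * R) \<le> 10 * (40 * C * (?q + ?X))"
      using R by (intro mult_mono[OF _ LA]) auto
    then show ?thesis by (intro fin) (simp add: mult_ac)
  next
    case 3
    \<comment> \<open>One of \<open>A1\<close>, \<open>B1\<close> is at least \<open>1 / sqrt 2\<close>, so \<open>d\<close> exceeds half of that.\<close>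
    have "(A1/2)\<^sup>2 \<le> d\<^sup>2" "(B1/2)\<^sup>2 \<le> d\<^sup>2" using 3 pos by (auto intro!: power_mono)
    then have d8: "d\<^sup>2 \<ge> 1/8" using circ(2) by (simp add: power_divide)
    have A1: "A1 \<le> 1" and A: "A \<le> 1" and B1: "B1 \<le> 1"
      using circ zero_le_power2[of A] zero_le_power2[of A1] zero_le_power2[of B] zero_le_power2[of B1]
        abs_square_le_1[of A] abs_square_le_1[of A1] abs_square_le_1[of B1] by linarith+
    have "(A / A1) powr \<alpha> \<le> (1 / A1) powr \<alpha>"
      using pos A \<alpha> by (intro powr_mono2) (auto simp: divide_right_mono)
    also have "\<dots> \<le> (1 / A1) powr (2 + \<beta>)" using pos A1 ab by (intro powr_mono) auto
    finally have a: "(A / A1) powr \<alpha> \<le> (1 / A1) powr (2 + \<beta>)" .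
    have "S \<le> S powr (-\<beta>)"
    proof (cases "S = 0")
      case False
      have "S powr 1 \<le> S powr (-\<beta>)" using S False \<beta> by (intro powr_mono') auto
      then show ?thesis using S False by simp
    qed simp
    also have "\<dots> \<le> (4 * N * B) powr (-\<beta>)" using S \<beta> by (intro powr_mono2) auto
    finally have "(B / B1) powr \<beta> * S \<le> (B / B1) powr \<beta> * (4 * N * B) powr (-\<beta>)"
      by (intro mult_left_mono) auto
    also have "\<dots> = (4 * N * B1) powr (-\<beta>)"
      using pos by (simp add: powr_mult powr_divide powr_minus field_simps)
    also have "\<dots> \<le> (2 * (2 * N)) powr (-\<beta>)"
      using pos B1 \<beta> by (intro powr_mono2) (auto simp: mult_le_cancel_left2)
    also have "\<dots> = 2 powr (-\<beta>) * (2 * N) powr (-\<beta>)" using pos by (subst powr_mult) auto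
    also have "\<dots> \<le> 2 powr 1 * (2 * N) powr (-\<beta>)" using \<beta> by (intro mult_right_mono powr_mono) auto
    finally have b: "(B / B1) powr \<beta> * S \<le> 2 * (2 * N) powr (-\<beta>)" by simp
    have "(N * d)\<^sup>2 \<ge> N\<^sup>2 * (1/8)" unfolding power_mult_distrib using d8 by (intro mult_left_mono) auto
    then have "R * (N\<^sup>2 * (1/8)) \<le> C * S" using R mult_left_mono[of "N\<^sup>2 * (1/8)" "(N*d)\<^sup>2" R] by linarith
    then have r: "R \<le> 8 * C / N\<^sup>2 * S" using pos by (simp add: field_simps)
    have "(A / A1) powr \<alpha> * ((B / B1) powr \<beta> * R) \<le> (1 / A1) powr (2 + \<beta>) * ((B / B1) powr \<beta> * (8 * C / N\<^sup>2 * S))"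
      using a r R by (intro mult_mono mult_left_mono) auto
    also have "\<dots> = (1 / A1) powr (2 + \<beta>) * (8 * C / N\<^sup>2) * ((B / B1) powr \<beta> * S)" by (simp add: mult_ac)
    also have "\<dots> \<le> (1 / A1) powr (2 + \<beta>) * (8 * C / N\<^sup>2) * (2 * (2 * N) powr (-\<beta>))"
      using b C by (intro mult_left_mono) auto
    also have "\<dots> = 64 * C * ((1 / A1) powr (2 + \<beta>) * ((2 * N) powr (-\<beta>) / (2 * N)\<^sup>2))"
      by (simp add: power_mult_distrib)
    also have "(2 * N) powr (-\<beta>) / (2 * N)\<^sup>2 = (2 * N) powr (-(2 + \<beta>))"
    proof -
      have "(2 * N) powr 2 = (2 * N)\<^sup>2" by (rule powr_numeral) (use pos in simp)
      moreover have "(2 * N) powr (-(2 + \<beta>)) = (2 * N) powr (-\<beta>) / (2 * N) powr 2"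
        unfolding powr_diff[symmetric] by (simp add: algebra_simps)
      ultimately show ?thesis by (simp only:)
    qed
    also have "(1 / A1) powr (2 + \<beta>) * (2 * N) powr (-(2 + \<beta>)) = (2 * N * A1) powr (-(2 + \<beta>))"
      using pos unfolding powr_minus_divide[of "2 * N"] powr_minus_divide[of "2 * N * A1"] by (simp add: powr_mult powr_divide)
    also have "64 * C * (2 * N * A1) powr (-(2 + \<beta>)) \<le> 10 * (40 * C * (2 * N * A1) powr (-p))"
      unfolding mult.assoc[symmetric] using C X1 p by (intro mult_mono powr_mono) auto
    also have "\<dots> \<le> 10 * (40 * C * (?q + ?X))" using nn C by (intro mult_left_mono) auto
    finally show ?thesis by (intro fin) (simp add: mult.assoc)
  qed
qed

text \<open>If both exponents have the same sign, one of the two factors is at most \<open>1\<close>, because \<open>A\<^sup>2 + B\<^sup>2 = A1\<^sup>2 + B1\<^sup>2\<close>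
excludes that both quotients lie on the same side of \<open>1\<close>. So the product is at most the sum of the factors
and the one-sided bounds apply.\<close>

lemma two_sided_bound:
  fixes A A1 B B1 d N R S C p \<alpha> \<beta> :: real
  assumes pos: "A > 0" "A1 > 0" "B > 0" "B1 > 0" "d \<ge> 0" "N > 0"
    and X1: "1 \<le> 2 * N * A1" and Y1: "1 \<le> 2 * N * B1"
    and circ: "A\<^sup>2 + B\<^sup>2 = 1" "A1\<^sup>2 + B1\<^sup>2 = 1"
    and tri: "A \<le> A1 + d" "A1 \<le> A + d" "B \<le> B1 + d" "B1 \<le> B + d"
    and R: "0 \<le> R" "R \<le> 4" "R * (N * d)\<^sup>2 \<le> C * S" and C: "C \<ge> 1"
    and S: "0 \<le> S" "S \<le> 1" "\<alpha> < 0 \<Longrightarrow> S \<le> 4 * N * A" "\<beta> < 0 \<Longrightarrow> S \<le> 4 * N * B"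
    and \<alpha>: "-1 < \<alpha>" "\<alpha> \<le> 2" and \<beta>: "-1 < \<beta>" "\<beta> \<le> 2" and ab: "\<bar>\<alpha> - \<beta>\<bar> \<le> 2"
    and p: "p \<le> 2" "p \<le> 2 + \<alpha>" "p \<le> 2 + \<beta>"
  shows "(A / A1) powr \<alpha> * (B / B1) powr \<beta> * R
    \<le> 400 * C * (1 / (1 + (N * d)\<^sup>2) + (2 * N * A1) powr (-p) + (2 * N * B1) powr (-p))"
proof -
  let ?q = "1 / (1 + (N * d)\<^sup>2)" and ?X = "(2 * N * A1) powr (-p)" and ?Y = "(2 * N * B1) powr (-p)"
  consider "\<alpha> \<ge> 0" "\<beta> < 0" | "\<alpha> < 0" "\<beta> \<ge> 0" | "\<alpha> \<ge> 0 \<longleftrightarrow> \<beta> \<ge> 0" by linarith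
  then show ?thesis
  proof cases
    case 1
    have "\<alpha> - \<beta> \<le> 2" using ab by linarith
    then show ?thesis
      using mixed_sign_bound[OF pos X1 Y1 circ tri R C S(1,2) S(4) 1(1) \<alpha>(2) \<beta>(1) 1(2) _ p(3)] by blast
  next
    case 2
    have "\<beta> - \<alpha> \<le> 2" "B\<^sup>2 + A\<^sup>2 = 1" "B1\<^sup>2 + A1\<^sup>2 = 1" using ab circ by linarith+
    then have "(B / B1) powr \<beta> * (A / A1) powr \<alpha> * R \<le> 400 * C * (?q + ?Y + ?X)"
      using mixed_sign_bound[OF pos(3,4,1,2,5,6) Y1 X1 _ _ tri(3,4,1,2) R C S(1,2) S(3) 2(2) \<beta>(2) \<alpha>(1) 2(1) _ p(2)]
      by blast
    then show ?thesis by (simp add: mult_ac add_ac)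
  next
    case 3
    have LA: "(A / A1) powr \<alpha> * R \<le> 40 * C * (?q + ?X)"
      using assms by (intro one_sided_bound) auto
    have LB: "(B / B1) powr \<beta> * R \<le> 40 * C * (?q + ?Y)"
      using assms by (intro one_sided_bound) auto
    have one: "(A / A1) powr \<alpha> \<le> 1 \<or> (B / B1) powr \<beta> \<le> 1"
    proof (cases "\<alpha> \<ge> 0")
      case True
      have "A \<le> A1 \<or> B \<le> B1"
      proof (rule ccontr)
        assume "\<not> ?thesis"
        then have "A1\<^sup>2 < A\<^sup>2" "B1\<^sup>2 < B\<^sup>2" using pos by (auto intro!: power_strict_mono)
        then show False using circ by simp
      qed
      then show ?thesis using True 3 pos by (auto intro!: powr_le1)
    next
      case False
      have "A1 \<le> A \<or> B1 \<le> B"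
      proof (rule ccontr)
        assume "\<not> ?thesis"
        then have "A\<^sup>2 < A1\<^sup>2" "B\<^sup>2 < B1\<^sup>2" using pos by (auto intro!: power_strict_mono)
        then show False using circ by simp
      qed
      then show ?thesis
        using False 3 pos powr_mono2'[of \<alpha> 1 "A / A1"] powr_mono2'[of \<beta> 1 "B / B1"] by auto
    qed
    let ?a = "(A / A1) powr \<alpha>" and ?b = "(B / B1) powr \<beta>"
    have "?a * ?b * R \<le> ?a * R + ?b * R"
    proof -
      have "?a * ?b \<le> ?a + ?b"
        using one
      proof
        assume "?a \<le> 1"
        then have "?a * ?b \<le> 1 * ?b" by (intro mult_right_mono) auto
        also have "\<dots> \<le> ?a + ?b" by simp
        finally show ?thesis .
      next
        assume "?b \<le> 1"
        then have "?a * ?b \<le> ?a * 1" by (intro mult_left_mono) auto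
        also have "\<dots> \<le> ?a + ?b" by simp
        finally show ?thesis .
      qed
      then show ?thesis using R mult_right_mono[of "?a * ?b" "?a + ?b" R] by (simp add: distrib_right)
    qed
    also have "\<dots> \<le> 40 * C * (?q + ?X) + 40 * C * (?q + ?Y)" using LA LB by (rule add_mono)
    also have "\<dots> = 40 * C * (2 * ?q + ?X + ?Y)" by (simp only: distrib_left mult_2 add_ac)
    also have "\<dots> \<le> 400 * C * (?q + ?X + ?Y)"
    proof -
      have aux: "2 * q + x + y \<le> 10 * (q + x + y)" if "0 \<le> q" "0 \<le> x" "0 \<le> y" for q x y :: real
        using that by (simp add: distrib_left)
      have "2 * ?q + ?X + ?Y \<le> 10 * (?q + ?X + ?Y)" by (rule aux) (auto simp: add_nonneg_nonneg)
      then have "40 * C * (2 * ?q + ?X + ?Y) \<le> 40 * C * (10 * (?q + ?X + ?Y))"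
        using C by (intro mult_left_mono) auto
      moreover have "40 * C * (10 * z) = 400 * C * z" for z by simp
      ultimately show ?thesis by (simp only:)
    qed
    finally show ?thesis .
  qed
qed

section \<open>Elementary trigonometric inequalities\<close>

text \<open>Jordan's inequality, from the concavity of the sine.\<close>

lemma sin_half_ge:
  assumes "0 \<le> x" "x \<le> pi"
  shows "x / pi \<le> sin (x / 2)"
proof -
  have "concave_on {0..pi} sin"
    by (rule f''_le0_imp_concave[of _ _ cos "\<lambda>x. - sin x"])
       (auto intro!: derivative_eq_intros sin_ge_zero)
  then have "(1 - x / pi) * sin 0 + (x / pi) * sin (pi / 2) \<le> sin ((1 - x / pi) *\<^sub>R 0 + (x / pi) *\<^sub>R (pi / 2))"
    using assms by (intro concave_onD) auto
  then show ?thesis by simp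
qed

lemma abs_sin_half_ge:
  assumes "\<bar>x\<bar> \<le> pi"
  shows "\<bar>x\<bar> / pi \<le> \<bar>sin (x / 2)\<bar>"
proof (cases "x \<ge> 0")
  case True then show ?thesis using sin_half_ge[of x] assms by simp
next
  case False then show ?thesis using sin_half_ge[of "-x"] assms by simp
qed

lemma cos_half_eq: "cos (t / 2) = sin ((pi - t) / 2)"
  by (simp add: diff_divide_distrib sin_diff)

lemma sin_perturb: "\<bar>sin (x::real)\<bar> \<le> \<bar>sin y\<bar> + \<bar>sin (x - y)\<bar>"
proof -
  have "sin x = sin y * cos (x - y) + cos y * sin (x - y)"
    using sin_add[of y "x - y"] by simp
  then have "\<bar>sin x\<bar> \<le> \<bar>sin y\<bar> * \<bar>cos (x - y)\<bar> + \<bar>cos y\<bar> * \<bar>sin (x - y)\<bar>"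
    using abs_triangle_ineq[of "sin y * cos (x - y)" "cos y * sin (x - y)"] by (simp add: abs_mult)
  also have "\<dots> \<le> \<bar>sin y\<bar> * 1 + 1 * \<bar>sin (x - y)\<bar>"
    by (intro add_mono mult_mono) auto
  finally show ?thesis by simp
qed

lemma cos_perturb: "\<bar>cos (x::real)\<bar> \<le> \<bar>cos y\<bar> + \<bar>sin (x - y)\<bar>"
proof -
  have "pi/2 - x - (pi/2 - y) = - (x - y)" by simp
  then show ?thesis
    using sin_perturb[of "pi/2 - x" "pi/2 - y"] by (simp only: cos_sin_eq sin_minus abs_minus_cancel of_real_eq_id id_apply)
qed

section \<open>Reflection of the interval\<close>

text \<open>The weight obtained from \<open>w\<close> by the substitution \<open>x \<mapsto> - x\<close>.\<close>

fun reflect :: "chebyshev \<Rightarrow> chebyshev" where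
  "reflect W1 = W1" | "reflect W2 = W2" | "reflect W3 = W4" | "reflect W4 = W3"

lemma reflect_simps [simp]:
  "reflect (reflect w) = w" "sin_exp (reflect w) = cos_exp w" "cos_exp (reflect w) = sin_exp w"
  "half_shift (reflect w) = half_shift w" "freq (reflect w) n = freq w n"
  by (cases w; simp add: half_shift_def freq_def)+

lemma osc_reflect: "\<bar>osc w (freq w n * (pi - t))\<bar> = \<bar>osc (reflect w) (freq w n * t)\<bar>"
proof -
  define y where "y = freq w n * t"
  have e: "freq w n * (pi - t) = real n * pi + (half_shift w * pi - y)"
    by (simp add: y_def freq_def algebra_simps)
  show ?thesis
    unfolding e y_def[symmetric]
    by (cases w) (simp_all add: osc_def half_shift_def sin_add cos_add sin_diff cos_diff abs_mult)
qed

lemma cheb_angle_reflection: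
  assumes "1 \<le> k" "k \<le> n"
  shows "cheb_angle (reflect w) n (n + 1 - k) = pi - cheb_angle w n k"
  using assms by (subst cheb_angle_reflect) (simp_all add: cheb_angle_eq of_nat_diff algebra_simps)

lemma vp_kernel_reflect: "vp_kernel (reflect w) n m \<theta> = vp_kernel w n m \<theta>"
  by (simp add: vp_kernel_def)

lemma vp_kernel_even: "vp_kernel w n m (- \<theta>) = vp_kernel w n m \<theta>"
  by (simp add: vp_kernel_def)

text \<open>Frequencies \<open>j + h\<close> are integers if \<open>h\<close> is \<open>0\<close> or \<open>1\<close>; they are half-integers if \<open>h = 1/2\<close>, and then the kernel
changes sign over a full period.\<close>

lemma vp_kernel_complement:
  "vp_kernel w n m (2 * pi - \<theta>) = (if half_shift w = 1/2 then -1 else 1) * vp_kernel w n m \<theta>"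
proof -
  have c: "cos ((real j + half_shift w) * (2 * pi - \<theta>))
     = (if half_shift w = 1/2 then -1 else 1) * cos ((real j + half_shift w) * \<theta>)" for j
  proof -
    have "(real j + half_shift w) * (2 * pi - \<theta>) = real (2 * j) * pi + (2 * half_shift w * pi - (real j + half_shift w) * \<theta>)"
      by (simp add: algebra_simps)
    moreover have "cos (real (2 * j) * pi) = 1" "sin (real (2 * j) * pi) = 0"
      unfolding cos_npi sin_npi by simp_all
    ultimately have "cos ((real j + half_shift w) * (2 * pi - \<theta>)) = cos (2 * half_shift w * pi - (real j + half_shift w) * \<theta>)"
      by (simp only: cos_add)
    then show ?thesis
      using half_shift_cases[of w] by (cases w) (simp_all add: half_shift_def cos_diff)
  qed
  show ?thesis
    unfolding vp_kernel_def c
    using half_shift_cases[of w] by (auto simp: sum_negf)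
qed

lemma vp_profile_reflect:
  assumes "1 \<le> k" "k \<le> n"
  shows "vp_profile w n m k (pi - t) = vp_profile (reflect w) n m (n + 1 - k) t"
proof -
  define \<tau> where "\<tau> = cheb_angle w n k"
  have t': "cheb_angle (reflect w) n (n + 1 - k) = pi - \<tau>"
    unfolding \<tau>_def by (rule cheb_angle_reflection[OF assms])
  have a: "vp_kernel w n m (pi - t - \<tau>) = vp_kernel w n m (t - (pi - \<tau>))"
    using vp_kernel_even[of w n m "t - (pi - \<tau>)"] by (simp add: algebra_simps)
  have b: "vp_kernel w n m (pi - t + \<tau>) = (if half_shift w = 1/2 then -1 else 1) * vp_kernel w n m (t + (pi - \<tau>))"
    using vp_kernel_complement[of w n m "t + (pi - \<tau>)"] by (simp add: algebra_simps)
  show ?thesis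
    unfolding vp_profile_def \<tau>_def[symmetric] t' vp_kernel_reflect a b reflect_simps
    by (cases w) (simp_all add: osc_sign_def half_shift_def)
qed

text \<open>The substitution \<open>t \<mapsto> \<pi> - t\<close> exchanges sine and cosine of the half angles and reverses the order of the
nodes.\<close>

lemma vp_lebesgue_reflect:
  "vp_lebesgue w \<alpha> \<beta> n m (pi - t) = vp_lebesgue (reflect w) \<beta> \<alpha> n m t"
proof -
  have "vp_lebesgue (reflect w) \<beta> \<alpha> n m t
    = (\<Sum>k=1..n. weight_ratio \<beta> \<alpha> t (cheb_angle (reflect w) n (n + 1 - k)) * vp_profile (reflect w) n m (n + 1 - k) t)"
    unfolding vp_lebesgue_def by (subst sum.atLeastAtMost_rev) simp
  also have "\<dots> = vp_lebesgue w \<alpha> \<beta> n m (pi - t)"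
    unfolding vp_lebesgue_def
  proof (intro sum.cong refl)
    fix k assume "k \<in> {1..n}"
    then have k: "1 \<le> k" "k \<le> n" by auto
    have "weight_ratio \<beta> \<alpha> t (pi - cheb_angle w n k) = weight_ratio \<alpha> \<beta> (pi - t) (cheb_angle w n k)"
      unfolding weight_ratio_def cos_half_eq by (simp add: mult.commute)
    then show "weight_ratio \<beta> \<alpha> t (cheb_angle (reflect w) n (n + 1 - k)) * vp_profile (reflect w) n m (n + 1 - k) t
      = weight_ratio \<alpha> \<beta> (pi - t) (cheb_angle w n k) * vp_profile w n m k (pi - t)"
      unfolding vp_profile_reflect[OF k] cheb_angle_reflection[OF k] by simp
  qed
  finally show ?thesis by simp
qed

section \<open>Uniform boundedness\<close>

lemma sum_le_suminf_reindex:
  fixes f :: "nat \<Rightarrow> real"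
  assumes "summable f" "\<And>i. f i \<ge> 0" "finite S" "inj_on g S" "\<And>k. k \<in> S \<Longrightarrow> h k \<le> f (g k)"
  shows "sum h S \<le> suminf f"
proof -
  have "sum h S \<le> (\<Sum>k\<in>S. f (g k))" using assms(5) by (rule sum_mono)
  also have "\<dots> = sum f (g ` S)" using assms(4) by (simp add: sum.reindex)
  also have "\<dots> \<le> suminf f" using assms by (intro sum_le_suminf) auto
  finally show ?thesis .
qed

lemma summable_cauchy_density: "summable (\<lambda>i. 1 / (1 + (real i)\<^sup>2))"
proof (rule summable_comparison_test')
  show "summable (\<lambda>n. inverse (real n ^ 2))" by (rule inverse_power_summable) simp
  show "norm (1 / (1 + (real n)\<^sup>2)) \<le> inverse ((real n)\<^sup>2)" if "n \<ge> 1" for n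
    using that by (simp add: field_simps add_pos_nonneg)
qed

text \<open>Seen from \<open>x\<close>, the integers on either side have distances at least \<open>0, 1, 2, \<dots>\<close>.\<close>

lemma sum_cauchy_density_le:
  "(\<Sum>k=1..n. 1 / (1 + (x - real k)\<^sup>2)) \<le> 2 * (\<Sum>i. 1 / (1 + (real i)\<^sup>2))"
proof -
  let ?f = "\<lambda>i. 1 / (1 + (real i)\<^sup>2)" and ?h = "\<lambda>k. 1 / (1 + (x - real k)\<^sup>2)"
  let ?L = "{k\<in>{1..n}. real k \<le> x}" and ?R = "{k\<in>{1..n}. \<not> real k \<le> x}"
  have mono: "1 / (1 + b\<^sup>2) \<le> 1 / (1 + a\<^sup>2)" if "\<bar>a\<bar> \<le> \<bar>b\<bar>" for a b :: real
    using that abs_le_square_iff[of a b] by (intro divide_left_mono) (auto intro!: mult_pos_pos add_pos_nonneg)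
  have "sum ?h ?L \<le> suminf ?f"
  proof (rule sum_le_suminf_reindex[OF summable_cauchy_density, where g = "\<lambda>k. nat \<lfloor>x\<rfloor> - k"])
    have le: "k \<le> nat \<lfloor>x\<rfloor>" if "k \<in> ?L" for k using that by (simp add: le_nat_floor)
    show "inj_on (\<lambda>k. nat \<lfloor>x\<rfloor> - k) ?L"
    proof (rule inj_onI)
      fix j k assume "j \<in> ?L" "k \<in> ?L" "nat \<lfloor>x\<rfloor> - j = nat \<lfloor>x\<rfloor> - k"
      then show "j = k" using le[of j] le[of k] by linarith
    qed
    fix k assume k: "k \<in> ?L"
    then have "x \<ge> 1" by auto
    then have "real (nat \<lfloor>x\<rfloor>) \<le> x" by simp
    moreover have "real (nat \<lfloor>x\<rfloor> - k) = real (nat \<lfloor>x\<rfloor>) - real k" by (rule of_nat_diff[OF le[OF k]])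
    ultimately show "?h k \<le> ?f (nat \<lfloor>x\<rfloor> - k)" by (intro mono) linarith
  qed auto
  moreover have "sum ?h ?R \<le> suminf ?f"
  proof (rule sum_le_suminf_reindex[OF summable_cauchy_density, where g = "\<lambda>k. k - nat \<lceil>x\<rceil>"])
    have le: "nat \<lceil>x\<rceil> \<le> k" if "k \<in> ?R" for k using that by (auto simp: nat_le_iff ceiling_le_iff)
    show "inj_on (\<lambda>k. k - nat \<lceil>x\<rceil>) ?R"
    proof (rule inj_onI)
      fix j k assume "j \<in> ?R" "k \<in> ?R" "j - nat \<lceil>x\<rceil> = k - nat \<lceil>x\<rceil>"
      then show "j = k" using le[of j] le[of k] by linarith
    qed
    fix k assume k: "k \<in> ?R"
    have "x \<le> real (nat \<lceil>x\<rceil>)" by linarith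
    moreover have "real (k - nat \<lceil>x\<rceil>) = real k - real (nat \<lceil>x\<rceil>)" by (rule of_nat_diff[OF le[OF k]])
    ultimately show "?h k \<le> ?f (k - nat \<lceil>x\<rceil>)" using k by (intro mono) auto
  qed auto
  moreover have "(\<Sum>k=1..n. ?h k) = sum ?h ?L + sum ?h ?R"
    by (subst sum.union_disjoint[symmetric]) (auto intro!: sum.cong)
  ultimately show ?thesis by linarith
qed

lemma sum_powr_le:
  fixes p :: real
  assumes "p > 1" "\<And>k. k \<in> {1..n} \<Longrightarrow> real k \<le> X k"
  shows "(\<Sum>k=1..n. X k powr (-p)) \<le> (\<Sum>i. real i powr (-p))"
proof (rule sum_le_suminf_reindex[where g = id])
  show "summable (\<lambda>i. real i powr (-p))" using assms(1) by (simp add: summable_real_powr_iff)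
  show "X k powr (-p) \<le> real (id k) powr (-p)" if "k \<in> {1..n}" for k
    using assms(1) assms(2)[OF that] that by (simp add: powr_mono2')
qed auto

lemma node_distance:
  assumes "1 \<le> k" "k \<le> n"
  shows "real k \<le> 2 * freq w n * sin (cheb_angle w n k / 2)"
    and "real (n + 1 - k) \<le> 2 * freq w n * cos (cheb_angle w n k / 2)"
proof -
  have *: "real k \<le> 2 * freq w n * sin (cheb_angle w n k / 2)" if "1 \<le> k" "k \<le> n" for w k
  proof -
    have f: "freq w n > 0" using that freq_bounds(1)[of n w] by linarith
    note r = cheb_angle_range[OF that, of w]
    have "real k \<le> 2 * real k - 1 + real (sin_exp w)" using that by simp
    also have "\<dots> = 2 * freq w n * (cheb_angle w n k / pi)" using f by (simp add: cheb_angle_eq)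
    also have "\<dots> \<le> 2 * freq w n * sin (cheb_angle w n k / 2)"
      using f r by (intro mult_left_mono sin_half_ge) auto
    finally show ?thesis .
  qed
  then show "real k \<le> 2 * freq w n * sin (cheb_angle w n k / 2)" using assms by blast
  have "real (n + 1 - k) \<le> 2 * freq (reflect w) n * sin (cheb_angle (reflect w) n (n + 1 - k) / 2)"
    using assms by (intro *) auto
  then show "real (n + 1 - k) \<le> 2 * freq w n * cos (cheb_angle w n k / 2)"
    unfolding cheb_angle_reflection[OF assms] cos_half_eq by simp
qed

text \<open>A sine system vanishes at \<open>t = 0\<close>; this compensates a negative exponent there.\<close>

lemma osc_vanishing:
  assumes "0 < t" "t < pi" "sin_exp w = 1"
  shows "\<bar>osc w (freq w n * t)\<bar> \<le> 4 * freq w n * sin (t / 2)"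
proof -
  have f: "freq w n \<ge> 0" using freq_bounds(1)[of n w] by linarith
  have "\<bar>osc w (freq w n * t)\<bar> \<le> freq w n * t"
    using assms f abs_sin_x_le_abs_x[of "freq w n * t"] by (simp add: osc_def)
  also have "t \<le> 4 * sin (t / 2)"
  proof -
    have "t / pi \<le> sin (t/2)" using assms by (intro sin_half_ge) auto
    then have "t \<le> pi * sin (t/2)" by (simp add: field_simps)
    also have "\<dots> \<le> 4 * sin (t/2)" using pi_less_4 assms by (intro mult_right_mono sin_ge_zero) auto
    finally show ?thesis .
  qed
  then have "freq w n * t \<le> freq w n * (4 * sin (t/2))" using f by (rule mult_left_mono)
  finally show ?thesis by simp
qed

text \<open>The bound of \<open>two_sided_bound\<close> is summed over the nodes. The first part is a sum of Cauchy densities over points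
of spacing \<open>1\<close>. The other two are dominated by the convergent series of \<open>k\<close> to the power \<open>-p\<close>, since the \<open>k\<close>-th node from an
endpoint has scaled distance at least \<open>k\<close> from it.\<close>

lemma vp_lebesgue_bounded:
  fixes \<alpha> \<beta> C :: real
  assumes C: "C \<ge> 1" and \<alpha>: "-1 < \<alpha>" "\<alpha> \<le> 2" and \<beta>: "-1 < \<beta>" "\<beta> \<le> 2" and ab: "\<bar>\<alpha> - \<beta>\<bar> \<le> 2"
    and van: "\<alpha> < 0 \<Longrightarrow> sin_exp w = 1" "\<beta> < 0 \<Longrightarrow> cos_exp w = 1"
  shows "\<exists>M. \<forall>n m t. 0 < m \<and> m < n \<and> real n \<le> C * real m \<and> 0 < t \<and> t < pi \<longrightarrow> vp_lebesgue w \<alpha> \<beta> n m t \<le> M"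
proof -
  \<comment> \<open>The smallest decay exponent of the three cases; it exceeds \<open>1\<close> since \<open>\<alpha>, \<beta> > -1\<close>.\<close>
  define p where "p = 2 + min 0 (min \<alpha> \<beta>)"
  have p: "p > 1" "p \<le> 2" "p \<le> 2 + \<alpha>" "p \<le> 2 + \<beta>" using \<alpha> \<beta> by (auto simp: p_def)
  define Z where "Z = (\<Sum>i. 1 / (1 + (real i)\<^sup>2))"
  define P where "P = (\<Sum>i. real i powr (-p))"
  have "vp_lebesgue w \<alpha> \<beta> n m t \<le> 400 * C * (2 * Z + P + P)"
    if h: "0 < m" "m < n" "real n \<le> C * real m" "0 < t" "t < pi" for n m t
  proof -
    define N where "N = freq w n"
    define S where "S = \<bar>osc w (N * t)\<bar>"
    have N: "N > 0" "N \<le> real n + 1" using h freq_bounds(1)[of n w] freq_bounds(2)[of w n] by (auto simp: N_def)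
    define q where "q k = 1 / (1 + (N * \<bar>sin ((t - cheb_angle w n k) / 2)\<bar>)\<^sup>2)" for k
    define X where "X k = 2 * N * sin (cheb_angle w n k / 2)" for k
    define Y where "Y k = 2 * N * cos (cheb_angle w n k / 2)" for k
    have XY: "real k \<le> X k" "real (n + 1 - k) \<le> Y k" if "k \<in> {1..n}" for k
      using node_distance[of k n w] that by (auto simp: X_def Y_def N_def)
    have termwise: "weight_ratio \<alpha> \<beta> t (cheb_angle w n k) * vp_profile w n m k t
      \<le> 400 * C * (q k + X k powr (-p) + Y k powr (-p))" if k: "k \<in> {1..n}" for k
    proof -
      define \<tau> where "\<tau> = cheb_angle w n k"
      have k': "1 \<le> k" "k \<le> n" using k by auto
      note r = cheb_angle_range[OF k', of w, folded \<tau>_def]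
      note hp = half_angle_pos[OF h(4,5)] half_angle_pos[OF r]
      have n0: "n > 0" using h by simp
      let ?d = "\<bar>sin ((t - \<tau>) / 2)\<bar>"
      have tri: "sin (t/2) \<le> sin (\<tau>/2) + ?d" "sin (\<tau>/2) \<le> sin (t/2) + ?d"
        "cos (t/2) \<le> cos (\<tau>/2) + ?d" "cos (\<tau>/2) \<le> cos (t/2) + ?d"
        using sin_perturb[of "t/2" "\<tau>/2"] sin_perturb[of "\<tau>/2" "t/2"]
          cos_perturb[of "t/2" "\<tau>/2"] cos_perturb[of "\<tau>/2" "t/2"] hp
          abs_minus_cancel[of "sin ((t - \<tau>) / 2)", unfolded sin_minus[symmetric]]
        by (simp_all add: diff_divide_distrib)
      have R3: "vp_profile w n m k t * (N * ?d)\<^sup>2 \<le> C * S"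
      proof -
        \<comment> \<open>Here \<open>n \<le> C m\<close> enters: it makes \<open>\<nu> m\<close> comparable to \<open>\<nu>\<^sup>2\<close>.\<close>
        have "N \<le> 2 * C * real m" using N(2) h by linarith
        then have "N * N \<le> (2 * C * real m) * N" using N by (intro mult_right_mono) auto
        then have "vp_profile w n m k t * ((sin ((t - \<tau>) / 2))\<^sup>2 * (N * N))
          \<le> vp_profile w n m k t * ((sin ((t - \<tau>) / 2))\<^sup>2 * ((2 * C * real m) * N))"
          by (intro mult_left_mono vp_profile_nonneg[OF n0]) auto
        also have "\<dots> = C * (vp_profile w n m k t * (2 * N * real m * (sin ((t - \<tau>) / 2))\<^sup>2))"
          by (simp only: mult_ac)
        also have "\<dots> \<le> C * S"
          using vp_profile_decay[OF h(1,2) k' h(4,5), of w] C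
          by (intro mult_left_mono) (auto simp: S_def N_def \<tau>_def)
        finally show ?thesis by (simp add: power2_eq_square mult_ac)
      qed
      have S: "0 \<le> S" "S \<le> 1" by (auto simp: S_def osc_def)
      have Sa: "S \<le> 4 * N * sin (t/2)" if "\<alpha> < 0"
        unfolding S_def N_def using van(1)[OF that] h by (intro osc_vanishing)
      have Sb: "S \<le> 4 * N * cos (t/2)" if "\<beta> < 0"
      proof -
        have "S = \<bar>osc (reflect w) (freq (reflect w) n * (pi - t))\<bar>"
          using osc_reflect[of "reflect w" n t] by (simp add: S_def N_def)
        also have "\<dots> \<le> 4 * freq (reflect w) n * sin ((pi - t) / 2)"
          using van(2)[OF that] h by (intro osc_vanishing) auto
        finally show ?thesis unfolding cos_half_eq by (simp add: N_def)
      qed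
      have X1: "1 \<le> 2 * N * sin (\<tau>/2)" "1 \<le> 2 * N * cos (\<tau>/2)"
        using XY[OF k] k' by (auto simp: X_def Y_def \<tau>_def)
      show ?thesis
        unfolding weight_ratio_def q_def X_def Y_def \<tau>_def[symmetric]
        using two_sided_bound[OF hp(1,3,2,4) _ N(1) X1 _ _ tri vp_profile_nonneg[OF n0]
          vp_profile_le_4[OF h(1,2)] R3 C S Sa Sb \<alpha> \<beta> ab p(2-4)]
        by simp
    qed
    have "(\<Sum>k=1..n. q k) \<le> (\<Sum>k=1..n. 1 / (1 + (N * t / pi + (1 - real (sin_exp w)) / 2 - real k)\<^sup>2))"
    proof (rule sum_mono)
      fix k assume k: "k \<in> {1..n}"
      define \<tau> where "\<tau> = cheb_angle w n k"
      have r: "0 < \<tau>" "\<tau> < pi" using cheb_angle_range[of k n w] k by (auto simp: \<tau>_def)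
      have "N * t / pi + (1 - real (sin_exp w)) / 2 - real k = N * ((t - \<tau>) / pi)"
        using N by (simp add: \<tau>_def cheb_angle_eq N_def field_simps)
      then have "\<bar>N * t / pi + (1 - real (sin_exp w)) / 2 - real k\<bar> = N * (\<bar>t - \<tau>\<bar> / pi)"
        using N by (simp add: abs_mult)
      also have "\<dots> \<le> N * \<bar>sin ((t - \<tau>) / 2)\<bar>"
        using N r h by (intro mult_left_mono abs_sin_half_ge) auto
      finally have "(N * t / pi + (1 - real (sin_exp w)) / 2 - real k)\<^sup>2 \<le> (N * \<bar>sin ((t - \<tau>) / 2)\<bar>)\<^sup>2"
        by (rule abs_le_square_iff[THEN iffD1, OF order.trans]) simp
      then show "q k \<le> 1 / (1 + (N * t / pi + (1 - real (sin_exp w)) / 2 - real k)\<^sup>2)"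
        unfolding q_def \<tau>_def[symmetric]
        by (intro divide_left_mono mult_pos_pos add_pos_nonneg) auto
    qed
    also have "\<dots> \<le> 2 * Z" unfolding Z_def by (rule sum_cauchy_density_le)
    finally have 1: "(\<Sum>k=1..n. q k) \<le> 2 * Z" .
    have 2: "(\<Sum>k=1..n. X k powr (-p)) \<le> P" unfolding P_def using p XY(1) by (intro sum_powr_le) auto
    have "(\<Sum>k=1..n. Y k powr (-p)) = (\<Sum>k=1..n. Y (n + 1 - k) powr (-p))"
      by (subst sum.atLeastAtMost_rev) simp
    also have "\<dots> \<le> P" unfolding P_def
    proof (rule sum_powr_le)
      fix k assume "k \<in> {1..n}"
      then have "n + 1 - k \<in> {1..n}" "n + 1 - (n + 1 - k) = k" by auto
      then show "real k \<le> Y (n + 1 - k)" using XY(2)[of "n + 1 - k"] by (simp only:)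
    qed (use p in auto)
    finally have 3: "(\<Sum>k=1..n. Y k powr (-p)) \<le> P" .
    have "vp_lebesgue w \<alpha> \<beta> n m t \<le> (\<Sum>k=1..n. 400 * C * (q k + X k powr (-p) + Y k powr (-p)))"
      unfolding vp_lebesgue_def by (rule sum_mono, rule termwise)
    also have "\<dots> = 400 * C * ((\<Sum>k=1..n. q k) + (\<Sum>k=1..n. X k powr (-p)) + (\<Sum>k=1..n. Y k powr (-p)))"
      unfolding sum_distrib_left[symmetric] sum.distrib ..
    also have "\<dots> \<le> 400 * C * (2 * Z + P + P)"
      using 1 2 3 C by (intro mult_left_mono add_mono) auto
    finally show ?thesis .
  qed
  then show ?thesis by blast
qed

section \<open>Unboundedness along resonant degrees\<close>

lemma weight_ratio_nonneg: "weight_ratio \<alpha> \<beta> t s \<ge> 0"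
  by (simp add: weight_ratio_def)

lemma cos_half_ge:
  assumes "0 \<le> s" "s \<le> pi / 2"
  shows "cos (s / 2) \<ge> 1 / 2"
proof -
  have "(pi - s) / pi \<le> cos (s / 2)" unfolding cos_half_eq using assms by (intro sin_half_ge) auto
  moreover have "1 / 2 \<le> (pi - s) / pi" using assms by (simp add: field_simps)
  ultimately show ?thesis by linarith
qed

text \<open>Covers both signs of the exponent at once.\<close>

lemma powr_ge_of_bounded_ratio:
  fixes b \<beta> :: real
  assumes "1 \<le> K" "1 / K \<le> b" "b \<le> K"
  shows "b powr \<beta> \<ge> K powr (-\<bar>\<beta>\<bar>)"
proof (cases "\<beta> \<ge> 0")
  case True
  have "K powr (-\<bar>\<beta>\<bar>) = (1 / K) powr \<beta>" using True assms by (simp add: powr_minus_divide powr_divide)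
  also have "\<dots> \<le> b powr \<beta>" using True assms by (intro powr_mono2) auto
  finally show ?thesis .
next
  case False
  have "0 < 1 / K" using assms by simp
  then have b: "b > 0" using assms(2) by linarith
  have "K powr (-\<bar>\<beta>\<bar>) = K powr \<beta>" using False by simp
  also have "\<dots> \<le> b powr \<beta>" using False assms b by (intro powr_mono2') auto
  finally show ?thesis .
qed

lemma powr_unbounded:
  fixes c e M :: real
  assumes "c > 0" "e > 0"
  shows "\<exists>j::nat. j \<ge> 1 \<and> (\<forall>x. x \<ge> real j \<longrightarrow> c * x powr e > M)"
proof -
  define y where "y = \<bar>M\<bar> / c + 1"
  obtain j :: nat where j: "real j \<ge> max 1 (y powr (1 / e))" using real_arch_simple by blast
  have y: "y > 0" using assms by (simp add: y_def add_nonneg_pos)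
  have "c * x powr e > M" if "x \<ge> real j" for x
  proof -
    have "y = (y powr (1 / e)) powr e" using assms y by (simp add: powr_powr)
    also have "\<dots> \<le> x powr e" using j that assms by (intro powr_mono2) auto
    finally have "c * y \<le> c * x powr e" using assms by (intro mult_left_mono) auto
    moreover have "c * y = \<bar>M\<bar> + c" using assms by (simp add: y_def field_simps)
    ultimately show ?thesis using assms by linarith
  qed
  then show ?thesis using j by (intro exI[of _ j]) auto
qed

text \<open>A family of degrees with \<open>n / m = 1 + 1 / Q\<close> fixed. Then \<open>(\<nu> - m) / \<nu>\<close> is bounded away from \<open>0\<close>, which keeps
all the oscillating factors of the lower estimate away from their zeros. The bound \<open>Q \<ge> 6\<close> keeps the
relevant angles within the first quadrant, and evenness of \<open>n\<close> and \<open>m\<close> makes \<open>t = \<pi>/2\<close> a zero of \<open>sin (m t)\<close>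
at which \<open>osc w (\<nu> t)\<close> is not small.\<close>

locale resonant_pair =
  fixes w :: chebyshev and Q j n m :: nat
  assumes Q: "Q \<ge> 6" and j: "j \<ge> 1" and n: "n = 2 * (Q + 1) * j" and m: "m = 2 * Q * j"
begin

abbreviation "\<nu> \<equiv> freq w n"

lemma sizes: "0 < m" "m < n" "1 \<le> n"
  using Q j by (auto simp: n m)

lemma real_sizes: "real n = 2 * (real Q + 1) * real j" "real m = 2 * real Q * real j"
  by (simp_all add: n m algebra_simps)

lemma gap: "real m + 2 * real j \<le> \<nu>" "\<nu> \<le> real m + 2 * real j + 1"
  using freq_bounds(1)[of n w] freq_bounds(2)[of w n] unfolding real_sizes
  by (simp_all add: algebra_simps)

lemma m_ge: "real m \<ge> 12 * real j"
  using Q unfolding real_sizes by (intro mult_right_mono) auto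

lemma freq_m: "real m \<le> \<nu>" "\<nu> \<le> 2 * real m" "2 \<le> \<nu>" "0 < real m" "real j \<le> \<nu>"
  using gap m_ge j by auto

lemma gap_ratio: "1 / (real Q + 2) \<le> (\<nu> - real m) / \<nu>" "1 / (real Q + 2) \<le> 2 * ((\<nu> - real m) / real m)"
  "(\<nu> - real m) / real m \<le> 1 / 4"
proof -
  have "\<nu> \<le> 2 * (real Q + 2) * real j"
    using gap j unfolding real_sizes by (simp add: algebra_simps)
  also have "\<dots> = (real Q + 2) * (2 * real j)" by simp
  also have "\<dots> \<le> (real Q + 2) * (\<nu> - real m)" using gap(1) by (intro mult_left_mono) auto
  finally have *: "\<nu> \<le> (real Q + 2) * (\<nu> - real m)" .
  then show 1: "1 / (real Q + 2) \<le> (\<nu> - real m) / \<nu>"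
    using freq_m by (simp add: field_simps)
  have "(\<nu> - real m) / \<nu> \<le> (\<nu> - real m) / real m"
    using freq_m by (intro divide_left_mono) auto
  moreover have "0 \<le> (\<nu> - real m) / real m" using freq_m by simp
  ultimately show "1 / (real Q + 2) \<le> 2 * ((\<nu> - real m) / real m)" using 1 by linarith
  show "(\<nu> - real m) / real m \<le> 1 / 4"
    using gap m_ge j freq_m by (simp add: field_simps)
qed

lemma first_node: "cheb_angle w n 1 = (1 + real (sin_exp w)) * pi / (2 * \<nu>)"
  "0 < cheb_angle w n 1" "cheb_angle w n 1 \<le> pi / \<nu>" "cheb_angle w n 1 \<le> pi / 2"
proof -
  show 1: "cheb_angle w n 1 = (1 + real (sin_exp w)) * pi / (2 * \<nu>)"
    by (simp add: cheb_angle_eq)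
  show "0 < cheb_angle w n 1" using cheb_angle_range(1)[of 1 n w] sizes by simp
  have "(1 + real (sin_exp w)) * pi / (2 * \<nu>) \<le> 2 * pi / (2 * \<nu>)"
    using freq_m by (intro divide_right_mono mult_right_mono) (cases w; simp)+
  then show 2: "cheb_angle w n 1 \<le> pi / \<nu>" unfolding 1 by simp
  have "pi / \<nu> \<le> pi / 2" using freq_m by (intro divide_left_mono) auto
  then show "cheb_angle w n 1 \<le> pi / 2" using 2 by linarith
qed

text \<open>For cosine systems \<open>m \<tau>\<^sub>1 = (m/\<nu>) \<pi>/2\<close> is at least \<open>\<pi>/4\<close> and at most \<open>\<pi>/2\<close>. For sine systems it is \<open>(m/\<nu>) \<pi>\<close>,
at distance \<open>\<pi> (\<nu> - m)/\<nu>\<close> from \<open>\<pi>\<close>.\<close>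

lemma sin_m_first_node: "sin (real m * cheb_angle w n 1) \<ge> 1 / (real Q + 2)"
proof -
  have c: "sin_exp w = 0 \<or> sin_exp w = 1" by (cases w) auto
  define r where "r = real m / \<nu>"
  have r: "r \<ge> 1 / 2" "r \<le> 1" using freq_m by (auto simp: r_def field_simps)
  show ?thesis
  proof (cases "sin_exp w = 0")
    case True
    have "r * pi / pi \<le> sin ((r * pi) / 2)"
      using r by (intro sin_half_ge) auto
    then have "r \<le> sin ((r * pi) / 2)" by simp
    moreover have "real m * cheb_angle w n 1 = (r * pi) / 2"
      unfolding first_node(1) r_def using True by simp
    moreover have "1 / (real Q + 2) \<le> 1 / 2" by (simp add: field_simps)
    ultimately show ?thesis using r by (simp only:)
  next
    case False
    then have s: "sin_exp w = 1" using c by simp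
    define y where "y = (\<nu> - real m) / \<nu>"
    have y: "0 \<le> y" "2 * y \<le> 1" using freq_m by (auto simp: y_def field_simps)
    have e: "real m * cheb_angle w n 1 = pi - (2 * y * pi) / 2"
      unfolding first_node(1) y_def using s freq_m by (simp add: field_simps)
    have "2 * y * pi / pi \<le> sin ((2 * y * pi) / 2)"
      using y by (intro sin_half_ge) auto
    then have "2 * y \<le> sin (real m * cheb_angle w n 1)" unfolding e by simp
    then show ?thesis using gap_ratio(1) y by (simp add: y_def[symmetric])
  qed
qed

text \<open>Since \<open>\<nu> \<pi>/m\<close> exceeds \<open>\<pi>\<close> by \<open>\<pi> (\<nu> - m)/m\<close>, which lies between a fixed positive number and \<open>\<pi>/4\<close>, neither the
sine nor the cosine is small.\<close>

lemma osc_first_mode: "\<bar>osc w (\<nu> * (pi / real m))\<bar> \<ge> 1 / (real Q + 2)"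
proof -
  define y where "y = (\<nu> - real m) / real m"
  have y: "0 \<le> y" "y \<le> 1/4" "1 / (real Q + 2) \<le> 2 * y"
    using freq_m gap_ratio by (auto simp: y_def)
  have e: "\<nu> * (pi / real m) = pi + (2 * y * pi) / 2"
    using freq_m by (simp add: y_def field_simps)
  have "2 * y * pi / pi \<le> sin ((2 * y * pi) / 2)"
    using y by (intro sin_half_ge) auto
  then have s: "2 * y \<le> sin (y * pi)" by simp
  have "cos ((2 * y * pi) / 2) \<ge> 1/2" using y by (intro cos_half_ge) auto
  then have c: "cos (y * pi) \<ge> 1/2" by simp
  have "1 / (real Q + 2) \<le> 1 / 2" by (simp add: field_simps)
  then show ?thesis unfolding e osc_def using s c y by (simp add: sin_add cos_add)
qed

lemma osc_middle: "\<bar>osc w (\<nu> * (pi / 2))\<bar> \<ge> 1 / (real Q + 2)"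
proof -
  have e: "\<nu> * (pi / 2) = real ((Q + 1) * j) * pi + half_shift w * (pi / 2)"
    by (simp add: freq_def n field_simps)
  have "\<bar>osc w (\<nu> * (pi / 2))\<bar> = \<bar>osc w (half_shift w * (pi / 2))\<bar>"
    unfolding e by (simp add: osc_def sin_add cos_add abs_mult del: of_nat_mult of_nat_add)
  also have "\<dots> \<ge> 1 / 2"
    using cos_half_ge[of "pi / 2"] sin_half_ge[of "pi / 2"]
    by (cases w) (simp_all add: osc_def half_shift_def)
  finally have "1 / 2 \<le> \<bar>osc w (\<nu> * (pi / 2))\<bar>" .
  moreover have "1 / (real Q + 2) \<le> 1 / 2" by (simp add: field_simps)
  ultimately show ?thesis by linarith
qed

lemma first_mode_range: "0 < pi / real m" "pi / real m \<le> pi / 2" "pi / real m < pi"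
proof -
  have "real m \<ge> 12" using m_ge j by linarith
  then show "0 < pi / real m" and *: "pi / real m \<le> pi / 2" by (auto simp: field_simps)
  show "pi / real m < pi" using * pi_gt_zero by linarith
qed

text \<open>The node next to \<open>x = 1\<close>, seen from a point \<open>t\<close> that stays away from \<open>t = 0\<close>: the sine quotient is of
order \<open>\<nu>\<close> and the profile of order \<open>\<nu>\<^sup>-\<^sup>2\<close>.\<close>

lemma vp_lebesgue_ge_first_term:
  assumes t: "0 < t" "t < pi" and z: "sin (real m * t) = 0" and A: "sin (t / 2) \<ge> 1 / 2"
    and S: "\<bar>osc w (\<nu> * t)\<bar> \<ge> 1 / (real Q + 2)" and \<alpha>: "\<alpha> \<ge> 0"
  shows "vp_lebesgue w \<alpha> \<beta> n m t \<ge>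
    (\<nu> / 4) powr \<alpha> * (cos (t / 2) / cos (cheb_angle w n 1 / 2)) powr \<beta> * (1 / (4 * (real Q + 2)\<^sup>2 * \<nu>\<^sup>2))"
proof -
  let ?\<tau> = "cheb_angle w n 1"
  have single: "weight_ratio \<alpha> \<beta> t ?\<tau> * vp_profile w n m 1 t \<le> vp_lebesgue w \<alpha> \<beta> n m t"
    unfolding vp_lebesgue_def using sizes
    by (intro member_le_sum[of 1 "{1..n}" "\<lambda>k. weight_ratio \<alpha> \<beta> t (cheb_angle w n k) * vp_profile w n m k t"])
       (auto intro!: mult_nonneg_nonneg weight_ratio_nonneg vp_profile_nonneg)
  have left: "(\<nu> / 4) powr \<alpha> \<le> (sin (t / 2) / sin (?\<tau> / 2)) powr \<alpha>"
  proof -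
    have sp: "sin (?\<tau> / 2) > 0"
      by (rule half_angle_pos(1)[OF first_node(2)]) (use first_node(4) pi_gt_zero in linarith)
    have "sin (?\<tau> / 2) \<le> ?\<tau> / 2" using first_node by (intro sin_x_le_x) auto
    also have "\<dots> \<le> 2 / \<nu>"
    proof -
      have "pi / \<nu> \<le> 4 / \<nu>" using pi_less_4 freq_m by (intro divide_right_mono) auto
      then have "?\<tau> / 2 \<le> 4 / \<nu> / 2" by (rule divide_right_mono[OF order.trans[OF first_node(3)]]) simp
      then show ?thesis by simp
    qed
    finally have "\<nu> * sin (?\<tau> / 2) \<le> 2" using freq_m by (simp add: field_simps)
    then have "\<nu> / 4 * sin (?\<tau> / 2) \<le> sin (t / 2)" using A by simp
    then have "\<nu> / 4 \<le> sin (t / 2) / sin (?\<tau> / 2)" using sp by (simp add: pos_le_divide_eq)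
    then show ?thesis using \<alpha> freq_m by (intro powr_mono2) auto
  qed
  have prof: "1 / (4 * (real Q + 2)\<^sup>2 * \<nu>\<^sup>2) \<le> vp_profile w n m 1 t"
  proof -
    have R: "vp_profile w n m 1 t \<ge> 0" using sizes by (intro vp_profile_nonneg) auto
    have "1 / (real Q + 2) * (1 / (real Q + 2)) \<le> \<bar>osc w (\<nu> * t)\<bar> * \<bar>sin (real m * ?\<tau>)\<bar>"
      using S sin_m_first_node by (intro mult_mono) auto
    also have "\<dots> \<le> vp_profile w n m 1 t * (4 * \<nu> * real m * (sin ((t + ?\<tau>) / 2))\<^sup>2)"
      using sizes t z by (intro vp_profile_lower) auto
    also have "\<dots> \<le> vp_profile w n m 1 t * (4 * \<nu> * \<nu> * 1)"
      using freq_m R by (intro mult_left_mono mult_mono) (auto simp: abs_square_le_1)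
    finally have "1 / (real Q + 2)\<^sup>2 \<le> vp_profile w n m 1 t * (4 * \<nu>\<^sup>2)" by (simp add: power2_eq_square mult_ac)
    then have "1 / (real Q + 2)\<^sup>2 / (4 * \<nu>\<^sup>2) \<le> vp_profile w n m 1 t"
      using freq_m by (subst pos_divide_le_eq) auto
    then show ?thesis by (simp add: mult_ac)
  qed
  have "(\<nu> / 4) powr \<alpha> * (cos (t / 2) / cos (?\<tau> / 2)) powr \<beta> * (1 / (4 * (real Q + 2)\<^sup>2 * \<nu>\<^sup>2))
     \<le> weight_ratio \<alpha> \<beta> t ?\<tau> * vp_profile w n m 1 t"
    unfolding weight_ratio_def by (rule mult_mono[OF mult_right_mono[OF left] prof]) auto
  then show ?thesis using single by (rule order.trans)
qed

lemma freq_powr: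
  "(\<nu> / 4) powr \<alpha> = 4 powr (-\<alpha>) * \<nu> powr \<alpha>" "\<nu> powr (\<alpha> - 2) = \<nu> powr \<alpha> / \<nu>\<^sup>2"
proof -
  have p: "\<nu> > 0" using freq_m by linarith
  show "(\<nu> / 4) powr \<alpha> = 4 powr (-\<alpha>) * \<nu> powr \<alpha>"
    using p by (simp add: powr_divide powr_minus_divide)
  have "\<nu> powr 2 = \<nu>\<^sup>2" by (rule powr_numeral) (use p in linarith)
  then show "\<nu> powr (\<alpha> - 2) = \<nu> powr \<alpha> / \<nu>\<^sup>2" by (simp only: powr_diff)
qed

text \<open>At \<open>t = \<pi>/2\<close> the cosine quotient lies between \<open>1/2\<close> and \<open>2\<close>.\<close>

lemma vp_lebesgue_middle:
  assumes \<alpha>: "\<alpha> \<ge> 0"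
  shows "vp_lebesgue w \<alpha> \<beta> n m (pi / 2) \<ge> 4 powr (-\<alpha>) * 2 powr (-\<bar>\<beta>\<bar>) / (4 * (real Q + 2)\<^sup>2) * \<nu> powr (\<alpha> - 2)"
proof -
  let ?B1 = "cos (cheb_angle w n 1 / 2)"
  have B: "1/2 \<le> cos (pi / 2 / 2)" "cos (pi / 2 / 2) \<le> 1" by (rule cos_half_ge) auto
  have B1: "1/2 \<le> ?B1" "?B1 \<le> 1" using first_node by (intro cos_half_ge) auto
  have "2 powr (-\<bar>\<beta>\<bar>) \<le> (cos (pi / 2 / 2) / ?B1) powr \<beta>"
  proof (rule powr_ge_of_bounded_ratio)
    have "1 / 2 * ?B1 \<le> 1 / 2 * 1" using B1 by (intro mult_left_mono) auto
    then have "1 / 2 * ?B1 \<le> cos (pi / 2 / 2)" using B by linarith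
    then show "1 / 2 \<le> cos (pi / 2 / 2) / ?B1" using B1 by (subst pos_le_divide_eq) auto
    have "cos (pi / 2 / 2) \<le> 2 * ?B1" "0 < ?B1" using B B1 by linarith+
    then show "cos (pi / 2 / 2) / ?B1 \<le> 2" by (simp only: pos_divide_le_eq)
  qed simp
  then have "(\<nu> / 4) powr \<alpha> * 2 powr (-\<bar>\<beta>\<bar>) * (1 / (4 * (real Q + 2)\<^sup>2 * \<nu>\<^sup>2))
     \<le> (\<nu> / 4) powr \<alpha> * (cos (pi / 2 / 2) / ?B1) powr \<beta> * (1 / (4 * (real Q + 2)\<^sup>2 * \<nu>\<^sup>2))"
    by (intro mult_right_mono mult_left_mono) auto
  also have "\<dots> \<le> vp_lebesgue w \<alpha> \<beta> n m (pi / 2)"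
  proof (intro vp_lebesgue_ge_first_term osc_middle \<alpha>)
    have "real m * (pi / 2) = real (Q * j) * pi" by (simp add: m)
    then show "sin (real m * (pi / 2)) = 0" by (simp only: sin_npi)
    show "sin (pi / 2 / 2) \<ge> 1 / 2" using sin_half_ge[of "pi / 2"] by simp
  qed auto
  also have "(\<nu> / 4) powr \<alpha> * 2 powr (-\<bar>\<beta>\<bar>) * (1 / (4 * (real Q + 2)\<^sup>2 * \<nu>\<^sup>2))
    = 4 powr (-\<alpha>) * 2 powr (-\<bar>\<beta>\<bar>) / (4 * (real Q + 2)\<^sup>2) * \<nu> powr (\<alpha> - 2)"
    unfolding freq_powr by simp
  finally show ?thesis .
qed

text \<open>At distance \<open>\<pi>/m\<close> from \<open>t = \<pi>\<close> the cosine quotient is of exact order \<open>1/\<nu>\<close>, which produces the additional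
power \<open>-\<beta>\<close>.\<close>

lemma vp_lebesgue_opposite_end:
  assumes \<alpha>: "\<alpha> \<ge> 0"
  shows "vp_lebesgue w \<alpha> \<beta> n m (pi - pi / real m) \<ge>
    4 powr (-\<alpha>) * 8 powr (-\<bar>\<beta>\<bar>) / (4 * (real Q + 2)\<^sup>2) * \<nu> powr (\<alpha> - \<beta> - 2)"
proof -
  let ?B1 = "cos (cheb_angle w n 1 / 2)" and ?t = "pi - pi / real m"
  note s = first_mode_range
  have B1: "1/2 \<le> ?B1" "?B1 \<le> 1" using first_node by (intro cos_half_ge) auto
  have Beq: "cos (?t / 2) = sin (pi / real m / 2)" unfolding cos_half_eq by simp
  have Aeq: "sin (?t / 2) = cos (pi / real m / 2)" unfolding cos_half_eq by simp
  have lo: "1 / \<nu> \<le> sin (pi / real m / 2)"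
  proof -
    have "1 / \<nu> \<le> 1 / real m" using freq_m by (intro divide_left_mono) auto
    also have "\<dots> = pi / real m / pi" by simp
    also have "\<dots> \<le> sin (pi / real m / 2)"
      by (rule sin_half_ge) (use s pi_gt_zero in linarith)+
    finally show ?thesis .
  qed
  have hi: "sin (pi / real m / 2) \<le> 4 / \<nu>"
  proof -
    have "sin (pi / real m / 2) \<le> pi / (2 * real m)" using sin_x_le_x[of "pi / real m / 2"] s by (simp add: mult.commute)
    also have "\<dots> \<le> pi / \<nu>" using freq_m by (intro divide_left_mono) auto
    also have "\<dots> \<le> 4 / \<nu>" using pi_less_4 freq_m by (intro divide_right_mono) auto
    finally show ?thesis .
  qed
  have "8 powr (-\<bar>\<beta>\<bar>) \<le> (\<nu> * (sin (pi / real m / 2) / ?B1)) powr \<beta>"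
  proof (rule powr_ge_of_bounded_ratio)
    have lo': "1 \<le> \<nu> * sin (pi / real m / 2)" and hi': "\<nu> * sin (pi / real m / 2) \<le> 4"
      using lo hi freq_m by (auto simp: field_simps)
    have "1 / 8 * ?B1 \<le> \<nu> * sin (pi / real m / 2)" "\<nu> * sin (pi / real m / 2) \<le> 8 * ?B1"
      using lo' hi' B1 by linarith+
    then have "1 / 8 \<le> \<nu> * sin (pi / real m / 2) / ?B1" "\<nu> * sin (pi / real m / 2) / ?B1 \<le> 8"
      using B1 by (auto simp only: pos_le_divide_eq pos_divide_le_eq)
    then show "1 / 8 \<le> \<nu> * (sin (pi / real m / 2) / ?B1)" "\<nu> * (sin (pi / real m / 2) / ?B1) \<le> 8" by simp_all
  qed simp
  also have "\<dots> = \<nu> powr \<beta> * (sin (pi / real m / 2) / ?B1) powr \<beta>"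
    using freq_m lo B1 by (intro powr_mult)
  finally have b: "8 powr (-\<bar>\<beta>\<bar>) * \<nu> powr (-\<beta>) \<le> (cos (?t / 2) / ?B1) powr \<beta>"
    unfolding Beq using freq_m by (simp add: powr_minus field_simps)
  have "(\<nu> / 4) powr \<alpha> * (8 powr (-\<bar>\<beta>\<bar>) * \<nu> powr (-\<beta>)) * (1 / (4 * (real Q + 2)\<^sup>2 * \<nu>\<^sup>2))
     \<le> (\<nu> / 4) powr \<alpha> * (cos (?t / 2) / ?B1) powr \<beta> * (1 / (4 * (real Q + 2)\<^sup>2 * \<nu>\<^sup>2))"
    using b by (intro mult_right_mono mult_left_mono) auto
  also have "\<dots> \<le> vp_lebesgue w \<alpha> \<beta> n m ?t"
  proof (intro vp_lebesgue_ge_first_term \<alpha>)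
    have "real m * ?t = real m * pi - pi" using freq_m by (simp add: right_diff_distrib)
    then show "sin (real m * ?t) = 0" by (simp add: sin_diff)
    show "sin (?t / 2) \<ge> 1 / 2" unfolding Aeq using s by (intro cos_half_ge) auto
    interpret r: resonant_pair "reflect w" Q j n m by unfold_locales (use Q j n m in auto)
    show "1 / (real Q + 2) \<le> \<bar>osc w (\<nu> * ?t)\<bar>" unfolding osc_reflect using r.osc_first_mode by simp
  qed (use s in auto)
  also have "(\<nu> / 4) powr \<alpha> * (8 powr (-\<bar>\<beta>\<bar>) * \<nu> powr (-\<beta>)) * (1 / (4 * (real Q + 2)\<^sup>2 * \<nu>\<^sup>2))
    = 4 powr (-\<alpha>) * 8 powr (-\<bar>\<beta>\<bar>) / (4 * (real Q + 2)\<^sup>2) * \<nu> powr (\<alpha> - \<beta> - 2)"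
  proof -
    have "\<nu> powr (\<alpha> - \<beta> - 2) = \<nu> powr \<alpha> * \<nu> powr (-\<beta>) / \<nu>\<^sup>2"
      using freq_powr(2)[of "\<alpha> - \<beta>"] powr_add[of \<nu> \<alpha> "-\<beta>"] by simp
    then show ?thesis unfolding freq_powr(1) by simp
  qed
  finally show ?thesis .
qed

end

text \<open>Two consecutive values \<open>sin (k \<phi>)\<close> and \<open>sin ((k + 1) \<phi>)\<close> cannot both be small, since their moduli add up to at
least \<open>\<bar>sin \<phi>\<bar>\<close>; grouping in pairs gives a harmonic sum.\<close>

lemma sum_abs_sin_over_index:
  "(\<Sum>k=1..2*i. \<bar>sin (real k * \<phi>)\<bar> / real k) \<ge> \<bar>sin \<phi>\<bar> / 2 * harm i"
proof (induction i)
  case 0 then show ?case by (simp add: harm_def)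
next
  case (Suc i)
  let ?f = "\<lambda>k. \<bar>sin (real k * \<phi>)\<bar>"
  have "\<bar>sin \<phi>\<bar> \<le> ?f (2 * i + 1) + ?f (2 * i + 2)"
    using sin_perturb[of \<phi> "real (2*i+2) * \<phi>"] abs_minus_cancel[of "sin (real (2*i+1) * \<phi>)", folded sin_minus]
    by (simp add: algebra_simps)
  then have "\<bar>sin \<phi>\<bar> / (2 * i + 2) \<le> (?f (2 * i + 1) + ?f (2 * i + 2)) / (2 * i + 2)"
    by (intro divide_right_mono) auto
  also have "\<dots> = ?f (2 * i + 1) / (2 * i + 2) + ?f (2 * i + 2) / (2 * i + 2)" by (rule add_divide_distrib)
  also have "\<dots> \<le> ?f (2 * i + 1) / (2 * i + 1) + ?f (2 * i + 2) / (2 * i + 2)"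
    by (intro add_right_mono divide_left_mono) auto
  finally have step: "\<bar>sin \<phi>\<bar> / (2 * i + 2) \<le> ?f (2 * i + 1) / (2 * i + 1) + ?f (2 * i + 2) / (2 * i + 2)" .
  have "(\<Sum>k=1..2 * Suc i. ?f k / real k) = (\<Sum>k=1..2*i. ?f k / real k) + (?f (2 * i + 1) / (2 * i + 1) + ?f (2 * i + 2) / (2 * i + 2))"
    by (simp add: add.assoc)
  moreover have "\<bar>sin \<phi>\<bar> / 2 * harm (Suc i) = \<bar>sin \<phi>\<bar> / 2 * harm i + \<bar>sin \<phi>\<bar> / (2 * i + 2)"
    by (simp add: harm_Suc field_simps)
  ultimately show ?case using Suc step by linarith
qed

context resonant_pair begin

text \<open>At \<open>t = \<pi>/m\<close> the \<open>k\<close>-th quotient is of order \<open>k\<close> for the exponent \<open>-1\<close>, and the \<open>k\<close>-th profile is at least a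
constant times \<open>\<bar>sin (m \<tau>\<^sub>k)\<bar> / k\<^sup>2\<close> with \<open>\<tau>\<^sub>k = k \<tau>\<^sub>1\<close>. Only the nodes in the right half of the interval are
used, where the cosine quotient is harmless.\<close>

lemma vp_lebesgue_log:
  assumes w: "sin_exp w = 1"
  shows "vp_lebesgue w (-1) \<beta> n m (pi / real m) \<ge>
    2 powr (-\<bar>\<beta>\<bar>) / (800 * (real Q + 2)\<^sup>2) * harm j"
proof -
  let ?t = "pi / real m" and ?\<phi> = "real m * cheb_angle w n 1"
  note t = first_mode_range(1,2) and t2 = first_mode_range(3)
  define c where "c = 2 powr (-\<bar>\<beta>\<bar>) / (400 * (real Q + 2))"
  have c: "c > 0" by (simp add: c_def)
  have termwise: "c * (\<bar>sin (real k * ?\<phi>)\<bar> / real k) \<le> weight_ratio (-1) \<beta> ?t (cheb_angle w n k) * vp_profile w n m k ?t"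
    if k: "k \<in> {1..2*j}" for k
  proof -
    define \<tau> where "\<tau> = cheb_angle w n k"
    have kj: "1 \<le> k" "k \<le> 2 * j" using k by auto
    have kr: "1 \<le> real k" "real k \<le> 2 * real j" using kj by auto
    have kn: "k \<le> n" using kj Q by (simp add: n)
    have \<tau>: "\<tau> = real k * pi / \<nu>" using w by (simp add: \<tau>_def cheb_angle_eq)
    have \<tau>1: "\<tau> = real k * cheb_angle w n 1" unfolding \<tau> first_node(1) using w by simp
    have \<tau>r: "0 < \<tau>" "\<tau> \<le> pi / 2"
    proof -
      show "0 < \<tau>" unfolding \<tau> using kr freq_m by (intro divide_pos_pos mult_pos_pos) auto
      have "2 * real k \<le> \<nu>" using kr gap(1) m_ge by linarith
      then have "real k * pi / \<nu> \<le> pi / 2" using freq_m by (simp add: field_simps)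
      then show "\<tau> \<le> pi / 2" by (simp add: \<tau>)
    qed
    have pos: "sin (\<tau> / 2) > 0" "cos (\<tau> / 2) > 0" "sin (?t / 2) > 0" "cos (?t / 2) > 0"
      using half_angle_pos[of \<tau>] half_angle_pos[of ?t] \<tau>r t t2 by auto
    have a: "real k / 4 \<le> (sin (?t / 2) / sin (\<tau> / 2)) powr (-1)"
    proof -
      have "sin (?t / 2) \<le> ?t / 2" using t by (intro sin_x_le_x) auto
      also have "\<dots> \<le> 4 / \<nu>"
      proof -
        have "pi * \<nu> \<le> 4 * (2 * real m)" using pi_less_4 freq_m by (intro mult_mono) auto
        then show ?thesis using freq_m by (simp add: field_simps)
      qed
      finally have "real k / 4 * sin (?t / 2) \<le> real k / 4 * (4 / \<nu>)" using kr by (intro mult_left_mono) auto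
      also have "\<dots> = \<tau> / pi" by (simp add: \<tau>)
      also have "\<dots> \<le> sin (\<tau> / 2)" using \<tau>r by (intro sin_half_ge) auto
      finally have "real k / 4 \<le> sin (\<tau> / 2) / sin (?t / 2)" using pos by (simp add: pos_le_divide_eq)
      then show ?thesis using pos by (simp add: powr_minus_divide)
    qed
    have b: "2 powr (-\<bar>\<beta>\<bar>) \<le> (cos (?t / 2) / cos (\<tau> / 2)) powr \<beta>"
    proof (rule powr_ge_of_bounded_ratio)
      have B: "1/2 \<le> cos (?t / 2)" "cos (?t / 2) \<le> 1" using t by (intro cos_half_ge) auto
      have B1: "1/2 \<le> cos (\<tau> / 2)" "cos (\<tau> / 2) \<le> 1" using \<tau>r by (intro cos_half_ge) auto
      have "1 / 2 * cos (\<tau> / 2) \<le> cos (?t / 2)" "cos (?t / 2) \<le> 2 * cos (\<tau> / 2)" using B B1 by linarith+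
      then show "1 / 2 \<le> cos (?t / 2) / cos (\<tau> / 2)" "cos (?t / 2) / cos (\<tau> / 2) \<le> 2"
        using pos(2) by (simp_all only: pos_le_divide_eq pos_divide_le_eq)
    qed simp
    have R: "vp_profile w n m k ?t \<ge> 0" using sizes by (intro vp_profile_nonneg) auto
    have r: "1 / (real Q + 2) * \<bar>sin (real k * ?\<phi>)\<bar> / (100 * (real k)\<^sup>2) \<le> vp_profile w n m k ?t"
    proof -
      have "1 / (real Q + 2) * \<bar>sin (real k * ?\<phi>)\<bar> \<le> \<bar>osc w (\<nu> * ?t)\<bar> * \<bar>sin (real m * \<tau>)\<bar>"
        unfolding \<tau>1 mult.left_commute[of "real k"] using osc_first_mode by (intro mult_right_mono) auto
      also have "\<dots> \<le> vp_profile w n m k ?t * (4 * \<nu> * real m * (sin ((?t + \<tau>) / 2))\<^sup>2)"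
        unfolding \<tau>_def using sizes t t2 kj kn by (intro vp_profile_lower) auto
      also have "\<dots> \<le> vp_profile w n m k ?t * (100 * (real k)\<^sup>2)"
      proof (rule mult_left_mono[OF _ R])
        have "?t \<le> 1 * (2 * pi / \<nu>)" using freq_m by (simp add: field_simps)
        also have "\<dots> \<le> real k * (2 * pi / \<nu>)" using kr freq_m by (intro mult_right_mono) auto
        finally have "(?t + \<tau>) / 2 \<le> (real k * (2 * pi / \<nu>) + \<tau>) / 2"
          by (intro divide_right_mono add_right_mono) auto
        also have "\<dots> = 3 * pi * real k / (2 * \<nu>)" using freq_m by (simp add: \<tau> field_simps)
        also have "\<dots> \<le> 5 * real k / \<nu>"
        proof -
          have "3 * pi \<le> 10" using pi_approx by simp
          then have "3 * pi * real k \<le> 10 * real k" by (intro mult_right_mono) auto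
          then show ?thesis using freq_m by (simp add: field_simps)
        qed
        finally have h: "(?t + \<tau>) / 2 \<le> 5 * real k / \<nu>" .
        have "sin ((?t + \<tau>) / 2) \<le> (?t + \<tau>) / 2" using t \<tau>r by (intro sin_x_le_x) auto
        then have "sin ((?t + \<tau>) / 2) \<le> 5 * real k / \<nu>" using h by linarith
        moreover have "0 \<le> sin ((?t + \<tau>) / 2)" using t \<tau>r by (intro sin_ge_zero) auto
        ultimately have "(sin ((?t + \<tau>) / 2))\<^sup>2 \<le> (5 * real k / \<nu>)\<^sup>2" by (intro power_mono) auto
        then have "4 * \<nu> * real m * (sin ((?t + \<tau>) / 2))\<^sup>2 \<le> 4 * \<nu> * \<nu> * (5 * real k / \<nu>)\<^sup>2"
          using freq_m by (intro mult_mono) auto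
        also have "\<dots> = 100 * (real k)\<^sup>2" using freq_m by (simp add: power2_eq_square field_simps)
        finally show "4 * \<nu> * real m * (sin ((?t + \<tau>) / 2))\<^sup>2 \<le> 100 * (real k)\<^sup>2" .
      qed
      finally have *: "1 / (real Q + 2) * \<bar>sin (real k * ?\<phi>)\<bar> \<le> vp_profile w n m k ?t * (100 * (real k)\<^sup>2)" .
      have "1 / (real Q + 2) * \<bar>sin (real k * ?\<phi>)\<bar> / (100 * (real k)\<^sup>2) \<le> vp_profile w n m k ?t"
        using * kr by (subst pos_divide_le_eq) auto
      then show ?thesis .
    qed
    have "c * (\<bar>sin (real k * ?\<phi>)\<bar> / real k)
      = real k / 4 * 2 powr (-\<bar>\<beta>\<bar>) * (1 / (real Q + 2) * \<bar>sin (real k * ?\<phi>)\<bar> / (100 * (real k)\<^sup>2))"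
    proof -
      have "x / (400 * L) * (y / \<kappa>) = \<kappa> / 4 * x * (1 / L * y / (100 * \<kappa>\<^sup>2))" if "\<kappa> > 0" "L > 0" for x y \<kappa> L :: real
        using that by (simp add: power2_eq_square field_simps)
      from this[of "real k" "real Q + 2"] show ?thesis unfolding c_def using kr by simp
    qed
    also have "\<dots> \<le> (sin (?t / 2) / sin (\<tau> / 2)) powr (-1) * (cos (?t / 2) / cos (\<tau> / 2)) powr \<beta> * vp_profile w n m k ?t"
      by (rule mult_mono[OF mult_mono[OF a b] r]) auto
    finally show ?thesis by (simp add: weight_ratio_def \<tau>_def)
  qed
  have "2 powr (-\<bar>\<beta>\<bar>) / (800 * (real Q + 2)\<^sup>2) * harm j = c * ((1 / (real Q + 2)) / 2 * harm j)"
  proof -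
    have "x / (800 * L\<^sup>2) * y = x / (400 * L) * ((1 / L) / 2 * y)" for x y L :: real
      by (simp add: power2_eq_square)
    then show ?thesis unfolding c_def by blast
  qed
  also have "\<dots> \<le> c * (\<bar>sin ?\<phi>\<bar> / 2 * harm j)"
    using sin_m_first_node c by (intro mult_left_mono mult_right_mono divide_right_mono harm_nonneg) auto
  also have "\<dots> \<le> c * (\<Sum>k=1..2*j. \<bar>sin (real k * ?\<phi>)\<bar> / real k)"
    using c by (intro mult_left_mono sum_abs_sin_over_index) auto
  also have "\<dots> \<le> (\<Sum>k=1..2*j. weight_ratio (-1) \<beta> ?t (cheb_angle w n k) * vp_profile w n m k ?t)"
    unfolding sum_distrib_left by (rule sum_mono, rule termwise)
  also have "\<dots> \<le> vp_lebesgue w (-1) \<beta> n m ?t"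
    unfolding vp_lebesgue_def using Q sizes
    by (intro sum_mono2) (auto simp: n intro!: mult_nonneg_nonneg weight_ratio_nonneg vp_profile_nonneg)
  finally show ?thesis .
qed

end

definition unbounded_family :: "chebyshev \<Rightarrow> real \<Rightarrow> real \<Rightarrow> nat \<Rightarrow> bool" where
  "unbounded_family w \<alpha> \<beta> Q \<longleftrightarrow>
     (\<forall>M. \<exists>j t. 1 \<le> j \<and> 0 < t \<and> t < pi \<and> vp_lebesgue w \<alpha> \<beta> (2 * (Q + 1) * j) (2 * Q * j) t > M)"

lemma unbounded_family_reflect:
  assumes "unbounded_family (reflect w) \<beta> \<alpha> Q"
  shows "unbounded_family w \<alpha> \<beta> Q"
  unfolding unbounded_family_def
proof
  fix M
  obtain j t where "1 \<le> j" "0 < t" "t < pi" "vp_lebesgue (reflect w) \<beta> \<alpha> (2 * (Q + 1) * j) (2 * Q * j) t > M"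
    using assms unfolding unbounded_family_def by blast
  then show "\<exists>j t. 1 \<le> j \<and> 0 < t \<and> t < pi \<and> vp_lebesgue w \<alpha> \<beta> (2 * (Q + 1) * j) (2 * Q * j) t > M"
    by (intro exI[of _ j] exI[of _ "pi - t"]) (simp add: vp_lebesgue_reflect)
qed

text \<open>Each way in which the conditions can fail at the endpoint \<open>x = 1\<close> has its own evaluation point.\<close>

lemma unbounded_family_left:
  assumes Q: "Q \<ge> 6" and \<beta>: "\<beta> \<ge> -1"
    and cases: "\<alpha> > 2 \<or> \<alpha> - \<beta> > 2 \<or> (\<alpha> = -1 \<and> sin_exp w = 1)"
  shows "unbounded_family w \<alpha> \<beta> Q"
  unfolding unbounded_family_def
proof
  fix M :: real
  have pair: "resonant_pair Q j (2 * (Q + 1) * j) (2 * Q * j)" if "j \<ge> 1" for j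
    using Q that by unfold_locales auto
  consider "\<alpha> > 2" | "\<alpha> - \<beta> > 2" | "\<alpha> = -1" "sin_exp w = 1" using cases by blast
  then show "\<exists>j t. 1 \<le> j \<and> 0 < t \<and> t < pi \<and> vp_lebesgue w \<alpha> \<beta> (2 * (Q + 1) * j) (2 * Q * j) t > M"
  proof cases
    case 1
    let ?c = "4 powr (-\<alpha>) * 2 powr (-\<bar>\<beta>\<bar>) / (4 * (real Q + 2)\<^sup>2)"
    have "?c > 0" by (intro divide_pos_pos mult_pos_pos) auto
    then obtain j where J: "j \<ge> 1" "\<And>x. x \<ge> real j \<Longrightarrow> ?c * x powr (\<alpha> - 2) > M"
      using powr_unbounded[of ?c "\<alpha> - 2" M] 1 by auto
    interpret resonant_pair w Q j "2 * (Q + 1) * j" "2 * Q * j" using pair[OF J(1)] .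
    have "M < vp_lebesgue w \<alpha> \<beta> (2 * (Q + 1) * j) (2 * Q * j) (pi / 2)"
      using J(2)[OF freq_m(5)] vp_lebesgue_middle[of \<alpha> \<beta>] 1 by linarith
    then show ?thesis using J(1) by (intro exI[of _ j] exI[of _ "pi / 2"]) auto
  next
    case 2
    let ?c = "4 powr (-\<alpha>) * 8 powr (-\<bar>\<beta>\<bar>) / (4 * (real Q + 2)\<^sup>2)"
    have "?c > 0" by (intro divide_pos_pos mult_pos_pos) auto
    then obtain j where J: "j \<ge> 1" "\<And>x. x \<ge> real j \<Longrightarrow> ?c * x powr (\<alpha> - \<beta> - 2) > M"
      using powr_unbounded[of ?c "\<alpha> - \<beta> - 2" M] 2 by auto
    interpret resonant_pair w Q j "2 * (Q + 1) * j" "2 * Q * j" using pair[OF J(1)] .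
    have "M < vp_lebesgue w \<alpha> \<beta> (2 * (Q + 1) * j) (2 * Q * j) (pi - pi / real (2 * Q * j))"
      using J(2)[OF freq_m(5)] vp_lebesgue_opposite_end[of \<alpha> \<beta>] 2 \<beta> by linarith
    moreover note first_mode_range(1,3)
    ultimately show ?thesis using J(1)
      by (intro exI[of _ j] exI[of _ "pi - pi / real (2 * Q * j)"]) (auto simp del: of_nat_mult)
  next
    case 3
    let ?c = "2 powr (-\<bar>\<beta>\<bar>) / (800 * (real Q + 2)\<^sup>2)"
    have c: "?c > 0" by (intro divide_pos_pos mult_pos_pos) auto
    have "eventually (\<lambda>j. harm j > M / ?c) sequentially"
      using harm_at_top by (rule filterlim_at_top_dense[THEN iffD1, rule_format])
    then have "eventually (\<lambda>j. harm j > M / ?c \<and> j \<ge> 1) sequentially"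
      using eventually_ge_at_top[of "1::nat"] by (rule eventually_conj)
    then obtain j :: nat where J: "harm j > M / ?c" "j \<ge> 1"
      using eventually_happens'[OF sequentially_bot] by blast
    interpret resonant_pair w Q j "2 * (Q + 1) * j" "2 * Q * j" using pair[OF J(2)] .
    have "M < ?c * harm j" using J(1) c by (simp only: pos_divide_less_eq mult.commute)
    then have "M < vp_lebesgue w \<alpha> \<beta> (2 * (Q + 1) * j) (2 * Q * j) (pi / real (2 * Q * j))"
      using vp_lebesgue_log[OF 3(2), of \<beta>] unfolding 3(1) by linarith
    moreover note first_mode_range(1,3)
    ultimately show ?thesis using J(2) by (intro exI[of _ j] exI[of _ "pi / real (2 * Q * j)"]) (auto simp del: of_nat_mult)
  qed
qed

section \<open>Characterization of boundedness\<close>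

text \<open>A nonnegative Jacobi exponent gives \<open>\<alpha> \<ge> -1\<close>, with a negative value only for sine systems; likewise for \<open>\<beta>\<close> after
reflection. So every failure of the conditions is one of those of \<open>unbounded_family_left\<close>, possibly
reflected.\<close>

lemma vp_uniformly_bounded_iff:
  fixes \<gamma> \<delta> C :: real and w :: chebyshev
  assumes g: "\<gamma> \<ge> 0" and d: "\<delta> \<ge> 0" and C: "C > 1"
  defines "\<alpha> \<equiv> 2 * \<gamma> - real (sin_exp w)" and "\<beta> \<equiv> 2 * \<delta> - real (cos_exp w)"
  shows "(SUP (n, m)\<in>{(n, m). 0 < m \<and> m < n \<and> real n \<le> C * real m}.
            lebesgue_const w (jacobi_weight \<gamma> \<delta>) n m) < \<infinity>
    \<longleftrightarrow> -1 < \<alpha> \<and> \<alpha> \<le> 2 \<and> -1 < \<beta> \<and> \<beta> \<le> 2 \<and> \<bar>\<alpha> - \<beta>\<bar> \<le> 2" (is "?S < \<infinity> \<longleftrightarrow> ?cond")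
proof -
  have e01: "sin_exp w = 0 \<or> sin_exp w = 1" "cos_exp w = 0 \<or> cos_exp w = 1" by (cases w; simp)+
  have "?S < \<infinity>" if ?cond
  proof -
    have van: "\<alpha> < 0 \<Longrightarrow> sin_exp w = 1" "\<beta> < 0 \<Longrightarrow> cos_exp w = 1"
      using g d e01 by (auto simp: \<alpha>_def \<beta>_def)
    have "\<exists>M. \<forall>n m t. 0 < m \<and> m < n \<and> real n \<le> C * real m \<and> 0 < t \<and> t < pi
        \<longrightarrow> vp_lebesgue w \<alpha> \<beta> n m t \<le> M"
      using that C van by (intro vp_lebesgue_bounded) auto
    then obtain M where M: "\<And>n m t. 0 < m \<and> m < n \<and> real n \<le> C * real m \<and> 0 < t \<and> t < pi
        \<Longrightarrow> vp_lebesgue w \<alpha> \<beta> n m t \<le> M"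
      by blast
    have "?S \<le> ereal M"
      by (intro SUP_least) (auto intro!: lebesgue_const_le g d M[unfolded \<alpha>_def \<beta>_def])
    also have "ereal M < \<infinity>" by simp
    finally show "?S < \<infinity>" .
  qed
  moreover have ?cond if fin: "?S < \<infinity>"
  proof (rule ccontr)
    assume neg: "\<not> ?cond"
    obtain Q0 :: nat where "real Q0 \<ge> 1 / (C - 1)" using real_arch_simple by blast
    \<comment> \<open>With \<open>Q \<ge> 1 / (C - 1)\<close> the ratio \<open>n / m = 1 + 1 / Q\<close> is at most \<open>C\<close>.\<close>
    define Q where "Q = max 6 Q0"
    have Q6: "Q \<ge> 6" by (simp add: Q_def)
    have "1 / (C - 1) \<le> real Q" using \<open>real Q0 \<ge> 1 / (C - 1)\<close> by (simp add: Q_def)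
    then have QC: "real Q + 1 \<le> C * real Q" using C by (simp add: field_simps)
    have ge: "\<alpha> \<ge> -1" "\<beta> \<ge> -1" using g d e01 by (auto simp: \<alpha>_def \<beta>_def)
    have am: "sin_exp w = 1" if "\<alpha> = -1" using that g e01 by (auto simp: \<alpha>_def)
    have bm: "cos_exp w = 1" if "\<beta> = -1" using that d e01 by (auto simp: \<beta>_def)
    have unb: "unbounded_family w \<alpha> \<beta> Q"
    proof (cases "\<alpha> > 2 \<or> \<alpha> - \<beta> > 2 \<or> (\<alpha> = -1 \<and> sin_exp w = 1)")
      case True then show ?thesis by (intro unbounded_family_left Q6 ge)
    next
      case False
      then have "\<beta> > 2 \<or> \<beta> - \<alpha> > 2 \<or> (\<beta> = -1 \<and> sin_exp (reflect w) = 1)"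
        using neg ge am bm by auto
      then show ?thesis
        by (intro unbounded_family_reflect[OF unbounded_family_left[OF Q6 ge(1)]])
    qed
    obtain B where B: "?S \<le> ereal B" using fin by (cases ?S) auto
    obtain j t where jt: "1 \<le> j" "0 < t" "t < pi" "vp_lebesgue w \<alpha> \<beta> (2 * (Q + 1) * j) (2 * Q * j) t > B"
      using unb unfolding unbounded_family_def by blast
    let ?n = "2 * (Q + 1) * j" and ?m = "2 * Q * j"
    have mn: "0 < ?m" "?m < ?n" using Q6 jt(1) by auto
    have "real ?n = (real Q + 1) * (2 * real j)" by (simp add: algebra_simps)
    also have "\<dots> \<le> C * real Q * (2 * real j)" using QC by (intro mult_right_mono) auto
    also have "\<dots> = C * real ?m" by simp
    finally have nm: "real ?n \<le> C * real ?m" .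
    have "ereal (vp_lebesgue w \<alpha> \<beta> ?n ?m t) \<le> lebesgue_const w (jacobi_weight \<gamma> \<delta>) ?n ?m"
      unfolding \<alpha>_def \<beta>_def by (rule lebesgue_const_ge[OF mn jt(2,3)])
    also have "\<dots> \<le> ?S"
      using SUP_upper[of "(?n, ?m)" "{(n, m). 0 < m \<and> m < n \<and> real n \<le> C * real m}"
        "\<lambda>(n, m). lebesgue_const w (jacobi_weight \<gamma> \<delta>) n m"] mn nm by simp
    also have "\<dots> \<le> ereal B" by (rule B)
    finally show False using jt(4) by simp
  qed
  ultimately show ?thesis by blast
qed

text \<open>Translation of the conditions on \<open>\<alpha> = 2 \<gamma> - e\<close> and \<open>\<beta> = 2 \<delta> - e'\<close>. The bound on \<open>\<bar>\<alpha> - \<beta>\<bar>\<close> is implied by the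
others for \<open>W1\<close>, and half of it for \<open>W3\<close> and \<open>W4\<close>.\<close>

theorem theorem3p1:
  fixes \<gamma> \<delta> C :: real and w :: chebyshev
  assumes "\<gamma> \<ge> 0" and "\<delta> \<ge> 0" and "C > 1"
  shows "(SUP (n, m)\<in>{(n, m). 0 < m \<and> m < n \<and> real n \<le> C * real m}.
            lebesgue_const w (jacobi_weight \<gamma> \<delta>) n m) < \<infinity>
    \<longleftrightarrow>
    (case w of
       W1 \<Rightarrow> 0 \<le> \<gamma> \<and> \<gamma> \<le> 1 \<and> 0 \<le> \<delta> \<and> \<delta> \<le> 1
     | W2 \<Rightarrow> 0 < \<gamma> \<and> \<gamma> \<le> 3/2 \<and> 0 < \<delta> \<and> \<delta> \<le> 3/2 \<and> -1 \<le> \<gamma> - \<delta> \<and> \<gamma> - \<delta> \<le> 1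
     | W3 \<Rightarrow> 0 \<le> \<gamma> \<and> \<gamma> \<le> 1 \<and> 0 < \<delta> \<and> \<delta> \<le> 3/2 \<and> \<gamma> - \<delta> \<le> 1/2
     | W4 \<Rightarrow> 0 < \<gamma> \<and> \<gamma> \<le> 3/2 \<and> 0 \<le> \<delta> \<and> \<delta> \<le> 1 \<and> \<gamma> - \<delta> \<ge> -1/2)"
  unfolding vp_uniformly_bounded_iff[OF assms]
  using assms by (cases w) (auto simp: abs_le_iff)

end
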